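(* There exists a deterministic polynomial-time algorithm that, given any $\varepsilon > 0$, any integer $f \geq 1$, and any graph $G(V,E)$ with $|V|=n$, computes a $(3/2+\varepsilon)$-approximate $f$-tolerant subgraph $H$ of $G$ with $O\!\left(\varepsilon^{-2}\left(n \log(1/\varepsilon) + f\right)\right)$ edges.
   Context: For a graph $G$, $\mu(G)$ denotes the size of a maximum matching. A subgraph $H$ of $G(V,E)$ is an $\alpha$-approximate $f$-tolerant subgraph of $G$ if for every set $F \subseteq E$ with $|F| \leq f$, $\mu(G \setminus F) \leq \alpha \cdot \mu(H \setminus F)$, where $G\setminus F$ and $H \setminus F$ denote the graphs with the edges of $F$ removed.
   Formalization: In the bound on the number of edges, ε is replaced by min(ε, 1/2): for ε ≤ 1/2 it is literally the stated bound, for larger ε it is O(n + f), since the stated expression fails at ε = 1 (a perfect matching with f = 1 needs at least n/5 edges) and can be negative for ε > 1. *)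

theory Defs
  imports
    Complex_Main
    "HOL-Computational_Algebra.Polynomial"
    "HOL-Library.Log_Nat"
begin

section \<open>Graphs, matchings, fault-tolerant subgraphs\<close>

text \<open>Graphs are finite, simple and undirected: an edge is a two-element set of vertices.
  A subgraph is spanning and given by its edge set.\<close>

definition graph :: "'a set \<Rightarrow> 'a set set \<Rightarrow> bool" where
  "graph V E \<longleftrightarrow> finite V \<and> (\<forall>e\<in>E. e \<subseteq> V \<and> card e = 2)"

definition matching :: "'a set set \<Rightarrow> 'a set set \<Rightarrow> bool" where
  "matching E M \<longleftrightarrow> M \<subseteq> E \<and> pairwise disjnt M"

definition matching_number :: "'a set set \<Rightarrow> nat" (\<open>\<mu>\<close>) where
  "\<mu> E = Max (card ` {M. matching E M})"

definition tolerant_subgraph :: "real \<Rightarrow> nat \<Rightarrow> 'a set set \<Rightarrow> 'a set set \<Rightarrow> bool" where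
  "tolerant_subgraph \<alpha> f E H \<longleftrightarrow>
     H \<subseteq> E \<and>
     (\<forall>F. F \<subseteq> E \<and> finite F \<and> card F \<le> f \<longrightarrow> real (\<mu> (E - F)) \<le> \<alpha> * real (\<mu> (H - F)))"

section \<open>Deterministic algorithms and their running time\<close>

text \<open>
  The machine model is a random access machine with a structured (while) program, operating on
  natural numbers under the logarithmic cost criterion: every access and every arithmetic
  operation is charged the binary length of the numbers (addresses and values) involved.
  Under this criterion polynomial time coincides with polynomial time on Turing machines,
  even though multiplication and division are primitive operations.

  The memory consists of named infinite arrays; a program mentions finitely many names.
  A scalar is cell 0 of its array.
\<close>

type_synonym vname = string
type_synonym state = "vname \<Rightarrow> nat \<Rightarrow> nat"

datatype bop = Add | Sub | Mul | Div | Less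

fun apply_bop :: "bop \<Rightarrow> nat \<Rightarrow> nat \<Rightarrow> nat" where
  "apply_bop Add a b = a + b"
| "apply_bop Sub a b = a - b"
| "apply_bop Mul a b = a * b"
| "apply_bop Div a b = a div b"
| "apply_bop Less a b = of_bool (a < b)"

datatype exp =
    Const nat
  | Cell vname exp
  | Op bop exp exp

fun val :: "exp \<Rightarrow> state \<Rightarrow> nat" where
  "val (Const k) s = k"
| "val (Cell x e) s = s x (val e s)"
| "val (Op b e1 e2) s = apply_bop b (val e1 s) (val e2 s)"

abbreviation bits :: "nat \<Rightarrow> nat" where
  "bits k \<equiv> floorlog 2 k"

text \<open>Operands and addresses are values of subexpressions, so their lengths are charged by the
  recursive calls.\<close>

fun cost :: "exp \<Rightarrow> state \<Rightarrow> nat" where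
  "cost (Const k) s = 1 + bits k"
| "cost (Cell x e) s = 1 + cost e s + bits (val (Cell x e) s)"
| "cost (Op b e1 e2) s = 1 + cost e1 s + cost e2 s + bits (val (Op b e1 e2) s)"

datatype com =
    Skip
  | Assign vname exp exp
  | Seq com com
  | If exp com com
  | While exp com

text \<open>\<open>exec c s t s'\<close>: program \<open>c\<close>, started in state \<open>s\<close>, halts after time \<open>t\<close> in state \<open>s'\<close>.
  \<open>Assign x i e\<close> stores \<open>e\<close> in cell \<open>i\<close> of array \<open>x\<close>; a nonzero condition counts as true.\<close>

inductive exec :: "com \<Rightarrow> state \<Rightarrow> nat \<Rightarrow> state \<Rightarrow> bool" where
  Skip: "exec Skip s 1 s"
| Assign: "exec (Assign x i e) s (1 + cost i s + cost e s) (s(x := (s x)(val i s := val e s)))"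
| Seq: "exec c1 s t1 s' \<Longrightarrow> exec c2 s' t2 s'' \<Longrightarrow> exec (Seq c1 c2) s (t1 + t2) s''"
| IfTrue: "val b s \<noteq> 0 \<Longrightarrow> exec c1 s t s' \<Longrightarrow> exec (If b c1 c2) s (1 + cost b s + t) s'"
| IfFalse: "val b s = 0 \<Longrightarrow> exec c2 s t s' \<Longrightarrow> exec (If b c1 c2) s (1 + cost b s + t) s'"
| WhileFalse: "val b s = 0 \<Longrightarrow> exec (While b c) s (1 + cost b s) s"
| WhileTrue: "val b s \<noteq> 0 \<Longrightarrow> exec c s t1 s' \<Longrightarrow> exec (While b c) s' t2 s'' \<Longrightarrow>
    exec (While b c) s (1 + cost b s + t1 + t2) s''"

lemma exec_deterministic:
  assumes "exec c s t s'" and "exec c s u s''"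
  shows "u = t \<and> s'' = s'"
  using assms
proof (induction arbitrary: u s'' rule: exec.induct)
  case (Skip s)
  then show ?case by (cases rule: exec.cases) simp_all
next
  case (Assign x i e s)
  then show ?case by (cases rule: exec.cases) simp_all
next
  case (Seq c1 s t1 s1 c2 t2 s2)
  from Seq.prems obtain v1 v2 r where "exec c1 s v1 r" "exec c2 r v2 s''" "u = v1 + v2"
    by (cases rule: exec.cases) simp_all
  with Seq.IH show ?case by metis
next
  case (IfTrue b s c1 t s1 c2)
  from IfTrue.prems \<open>val b s \<noteq> 0\<close> obtain v where "exec c1 s v s''" "u = 1 + cost b s + v"
    by (cases rule: exec.cases) simp_all
  with IfTrue.IH show ?case by metis
next
  case (IfFalse b s c2 t s1 c1)
  from IfFalse.prems \<open>val b s = 0\<close> obtain v where "exec c2 s v s''" "u = 1 + cost b s + v"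
    by (cases rule: exec.cases) simp_all
  with IfFalse.IH show ?case by metis
next
  case (WhileFalse b s c)
  from WhileFalse.prems \<open>val b s = 0\<close> show ?case by (cases rule: exec.cases) simp_all
next
  case (WhileTrue b s c t1 s1 t2 s2)
  from WhileTrue.prems \<open>val b s \<noteq> 0\<close> obtain v1 v2 r where
    "exec c s v1 r" "exec (While b c) r v2 s''" "u = 1 + cost b s + v1 + v2"
    by (cases rule: exec.cases) simp_all
  with WhileTrue.IH show ?case by metis
qed

section \<open>Encoding of inputs and outputs\<close>

text \<open>A graph with vertex set \<open>{..<n}\<close> is stored as its adjacency matrix, row by row.\<close>

definition adj_matrix :: "nat \<Rightarrow> nat set set \<Rightarrow> nat \<Rightarrow> nat" where
  "adj_matrix n E = (\<lambda>i. of_bool (i < n * n \<and> {i div n, i mod n} \<in> E))"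

text \<open>The numbers \<open>p\<close> and \<open>q\<close> represent the accuracy parameter as the fraction \<open>p / q\<close>.\<close>

definition input_state :: "nat \<Rightarrow> nat set set \<Rightarrow> nat \<Rightarrow> nat \<Rightarrow> nat \<Rightarrow> state" where
  "input_state n E f p q = (\<lambda>x i.
     if x = ''G'' then adj_matrix n E i
     else if i \<noteq> 0 then 0
     else if x = ''n'' then n
     else if x = ''f'' then f
     else if x = ''p'' then p
     else if x = ''q'' then q
     else 0)"

definition input_length :: "nat \<Rightarrow> nat \<Rightarrow> nat \<Rightarrow> nat \<Rightarrow> nat" where
  "input_length n f p q = n * n + bits n + bits f + bits p + bits q"

definition outputs :: "nat \<Rightarrow> nat set set \<Rightarrow> state \<Rightarrow> bool" where
  "outputs n H s \<longleftrightarrow> (\<forall>i < n * n. s ''H'' i = adj_matrix n H i)"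

text \<open>A real number \<open>\<epsilon> > 0\<close> is not a finite object. It is handed to a program as a fraction that
  approximates it from below up to a factor of two; a rational \<open>\<epsilon>\<close> may be given exactly.\<close>

definition represents :: "nat \<Rightarrow> nat \<Rightarrow> real \<Rightarrow> bool" where
  "represents p q \<epsilon> \<longleftrightarrow> \<epsilon> / 2 \<le> real p / real q \<and> real p / real q \<le> \<epsilon>"

end

theory Submission
  imports Defs
begin

text \<open>
  The subgraph is an edge-degree constrained subgraph (EDCS) \<open>H\<close>: the endpoint degrees of an edge of \<open>H\<close>
  sum up to at most \<open>\<beta>\<close>, those of an edge of \<open>E - H\<close> to at least \<open>\<beta> - 1\<close>. Local search finds one, since
  every correction increases \<open>(2 * \<beta> - 1) * card H - (\<Sum>v. (deg H v)\<^sup>2)\<close>.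

  Such a graph satisfies \<open>\<mu> E \<le> (3/2 + O(\<eta>)) * \<mu> H\<close> as soon as \<open>\<beta> \<ge> 64 / \<eta>\<^sup>2\<close>. To reduce to bipartite graphs,
  fix a maximum matching \<open>M\<close> of \<open>E\<close> and choose signs of the vertices, opposite along \<open>M\<close>, such that the
  edges of \<open>H\<close> between opposite signs halve all degrees up to \<open>O(sqrt \<beta>)\<close> in a weighted average; a second
  moment suffices. Let \<open>C\<close> be a vertex cover of these edges with \<open>card C \<le> \<mu> H\<close> (Koenig) and let \<open>W\<close> be the
  set of endpoints of the edges of \<open>M\<close> that \<open>C\<close> misses. These edges are not in \<open>H\<close>, so \<open>W\<close> has average
  degree at least about \<open>\<beta> / 4\<close> into \<open>C\<close>. But the endpoint degrees of an edge sum up to about \<open>\<beta> / 2\<close>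
  after halving, so that every subgraph has average degree at most about \<open>\<beta> / 4\<close>. Hence \<open>W\<close> is not much larger than \<open>C\<close>.

  Deleting \<open>f\<close> edges damages only \<open>O(f / (\<eta> * \<beta>))\<close> vertices seriously. If \<open>card H\<close> is at least a large
  multiple of \<open>f / \<eta>\<^sup>2\<close>, then these vertices are negligible compared with \<open>\<mu> (H - F) \<ge> (card H - f) / (2 * \<beta>)\<close>.
  Therefore \<open>\<beta>\<close> is doubled until \<open>H\<close> has that many edges or \<open>H = E\<close>; doubling \<open>\<beta>\<close> multiplies the number
  of edges by a constant at most.
\<close>

section \<open>Matchings and degrees\<close>

definition deg :: "'a set set \<Rightarrow> 'a \<Rightarrow> nat" where
  "deg H v = card {e\<in>H. v \<in> e}"

lemma graph_finite: "graph V E \<Longrightarrow> finite E"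
  unfolding graph_def by (meson finite_Pow_iff finite_subset PowI subsetI)

lemma graph_mono: "graph V E \<Longrightarrow> H \<subseteq> E \<Longrightarrow> graph V H"
  unfolding graph_def by blast

lemma graph_edge: "graph V E \<Longrightarrow> e \<in> E \<Longrightarrow> finite e \<and> e \<subseteq> V \<and> card e = 2"
  unfolding graph_def by (meson finite_subset)

lemma finite_matchings: "finite E \<Longrightarrow> finite {M. matching E M}"
  unfolding matching_def by (rule finite_subset[of _ "Pow E"]) auto

lemma card_le_matching_number:
  assumes "finite E" "matching E M" shows "card M \<le> \<mu> E"
  unfolding matching_number_def
  using assms by (intro Max_ge) (auto simp: finite_matchings)

lemma obtain_maximum_matching:
  assumes "finite E" obtains M where "matching E M" "card M = \<mu> E"
proof -
  have "matching E {}" by (simp add: matching_def)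
  then have "\<mu> E \<in> card ` {M. matching E M}"
    unfolding matching_number_def using assms by (intro Max_in) (auto simp: finite_matchings)
  then show thesis using that by auto
qed

lemma matching_number_mono:
  assumes "finite E" "H \<subseteq> E" shows "\<mu> H \<le> \<mu> E"
proof -
  obtain M where "matching H M" "card M = \<mu> H"
    using obtain_maximum_matching assms finite_subset by metis
  moreover have "matching E M" using \<open>matching H M\<close> assms by (auto simp: matching_def)
  ultimately show ?thesis using card_le_matching_number assms by metis
qed

text \<open>A vertex of \<open>D\<close> lies on at most one edge of the matching, so picking from
  each touched edge one of its vertices in \<open>D\<close> is injective.\<close>

lemma card_touched_le:
  assumes "pairwise disjnt M" "finite D"
  shows "card {e\<in>M. e \<inter> D \<noteq> {}} \<le> card D"
proof -
  define g where "g e = (SOME v. v \<in> e \<inter> D)" for e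
  have g: "g e \<in> e \<inter> D" if "e \<inter> D \<noteq> {}" for e
    unfolding g_def using that by (metis ex_in_conv someI_ex)
  have "inj_on g {e\<in>M. e \<inter> D \<noteq> {}}"
  proof (rule inj_onI)
    fix e e' assume a: "e \<in> {e\<in>M. e \<inter> D \<noteq> {}}" "e' \<in> {e\<in>M. e \<inter> D \<noteq> {}}" "g e = g e'"
    then have "g e \<in> e" "g e \<in> e'" using g by (metis (mono_tags, lifting) IntD1 mem_Collect_eq)+
    then have "\<not> disjnt e e'" by (auto simp: disjnt_def)
    then show "e = e'" using a assms(1) by (auto simp: pairwise_def)
  qed
  moreover have "g ` {e\<in>M. e \<inter> D \<noteq> {}} \<subseteq> D" using g by auto
  ultimately show ?thesis using assms(2) by (metis card_inj_on_le)
qed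

lemma matching_number_delete_vertices:
  assumes "finite E" "finite D"
  shows "\<mu> E \<le> \<mu> {e\<in>E. e \<inter> D = {}} + card D"
proof -
  obtain M where M: "matching E M" "card M = \<mu> E"
    using obtain_maximum_matching assms by metis
  have fM: "finite M" using M assms finite_subset by (auto simp: matching_def)
  have "matching {e\<in>E. e \<inter> D = {}} {e\<in>M. e \<inter> D = {}}"
    using M by (auto simp: matching_def pairwise_def)
  then have "card {e\<in>M. e \<inter> D = {}} \<le> \<mu> {e\<in>E. e \<inter> D = {}}"
    using assms by (intro card_le_matching_number) auto
  moreover have "card {e\<in>M. e \<inter> D \<noteq> {}} \<le> card D"
    using card_touched_le M assms by (auto simp: matching_def)
  moreover have "card M = card {e\<in>M. e \<inter> D = {}} + card {e\<in>M. e \<inter> D \<noteq> {}}"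
    using fM by (subst card_Un_disjoint[symmetric]) (auto intro!: arg_cong[where f=card])
  ultimately show ?thesis using M by linarith
qed

lemma card_Union_matching:
  assumes "graph V E" "matching E M"
  shows "card (\<Union>M) = 2 * card M"
proof -
  have "card (\<Union>M) = sum card M"
    using assms by (intro card_Union_disjoint) (auto simp: matching_def dest: graph_edge)
  also have "\<dots> = (\<Sum>e\<in>M. 2)"
    using assms by (intro sum.cong) (auto simp: matching_def dest: graph_edge)
  finally show ?thesis by simp
qed

text \<open>Double counting of incidences. \<open>g = 1\<close> gives the handshake identity;
  \<open>g = deg H\<close> turns the sum of squared degrees into a sum over edges.\<close>

lemma sum_edges_sum_vertices:
  fixes g :: "'a \<Rightarrow> 'b::comm_semiring_1"
  assumes "finite V" "finite H" "\<And>e. e \<in> H \<Longrightarrow> e \<subseteq> V"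
  shows "(\<Sum>e\<in>H. \<Sum>v\<in>e. g v) = (\<Sum>v\<in>V. of_nat (deg H v) * g v)"
proof -
  have "(\<Sum>e\<in>H. \<Sum>v\<in>e. g v) = (\<Sum>e\<in>H. \<Sum>v | v \<in> V \<and> v \<in> e. g v)"
    using assms(3) by (intro sum.cong refl) auto
  also have "\<dots> = (\<Sum>v\<in>V. \<Sum>e | e \<in> H \<and> v \<in> e. g v)"
    using assms by (intro sum.swap_restrict) auto
  finally show ?thesis by (simp add: deg_def)
qed

lemma handshake:
  assumes "graph V H" shows "(\<Sum>v\<in>V. deg H v) = 2 * card H"
proof -
  have "(\<Sum>v\<in>V. deg H v) = (\<Sum>e\<in>H. \<Sum>v\<in>e. 1)"
    using assms graph_finite[OF assms]
    by (subst sum_edges_sum_vertices[of V]) (auto simp: graph_def)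
  also have "\<dots> = (\<Sum>e\<in>H. 2)"
    using assms by (intro sum.cong) (auto dest: graph_edge)
  finally show ?thesis by simp
qed

lemma deg_mono: "finite H \<Longrightarrow> L \<subseteq> H \<Longrightarrow> deg L v \<le> deg H v"
  unfolding deg_def by (intro card_mono) auto

lemma card_le_cover:
  assumes "finite C" "finite H" "\<And>e. e \<in> H \<Longrightarrow> e \<inter> C \<noteq> {}" "\<And>v. v \<in> C \<Longrightarrow> deg H v \<le> k"
  shows "card H \<le> card C * k"
proof -
  have "H \<subseteq> (\<Union>v\<in>C. {e\<in>H. v \<in> e})" using assms(3) by blast
  then have "card H \<le> card (\<Union>v\<in>C. {e\<in>H. v \<in> e})"
    using assms by (intro card_mono) auto
  also have "\<dots> \<le> (\<Sum>v\<in>C. card {e\<in>H. v \<in> e})" using assms by (intro card_UN_le)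
  also have "\<dots> \<le> (\<Sum>v\<in>C. k)" using assms(4) by (intro sum_mono) (auto simp: deg_def)
  finally show ?thesis by simp
qed

text \<open>The endpoints of a maximum matching form a vertex cover with \<open>2 * \<mu> H\<close>
  vertices, each of which accounts for at most \<open>k\<close> edges.\<close>

lemma card_le_matching_number_degree:
  assumes "graph V H" "\<And>v. deg H v \<le> k"
  shows "card H \<le> 2 * \<mu> H * k"
proof -
  have fH: "finite H" using assms graph_finite by metis
  obtain M where M: "matching H M" "card M = \<mu> H"
    using obtain_maximum_matching fH by metis
  have fM: "finite M" using M fH finite_subset by (auto simp: matching_def)
  have fU: "finite (\<Union>M)" using M fM assms by (auto simp: matching_def dest: graph_edge)
  have "e \<inter> \<Union>M \<noteq> {}" if e: "e \<in> H" for e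
  proof
    assume a: "e \<inter> \<Union>M = {}"
    have "e \<noteq> {}" using e assms(1) graph_edge by fastforce
    then have "e \<notin> M" using a by auto
    have "matching H (insert e M)"
      using M e a by (auto simp: matching_def pairwise_insert disjnt_def)
    then have "card (insert e M) \<le> \<mu> H" using fH card_le_matching_number by metis
    then show False using \<open>e \<notin> M\<close> fM M by simp
  qed
  then have "card H \<le> card (\<Union>M) * k" using card_le_cover assms fH fU by metis
  then show ?thesis using card_Union_matching[OF assms(1) M(1)] M by simp
qed

section \<open>Koenig's theorem\<close>

text \<open>Two edges \<open>e\<close>, \<open>f\<close> meeting in a vertex are deleted one at a time. If neither of the two
  covers obtained by induction covers the deleted edge, uncrossing them yields two covers of the
  whole graph whose sizes add up to at most one more than before.\<close>

lemma uncross_covers: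
  assumes bip: "\<And>g. g \<in> E \<Longrightarrow> \<exists>a b. g = {a, b} \<and> a \<in> A \<and> b \<notin> A"
    and e: "e \<in> E" "f \<in> E" "e \<noteq> f" "v \<in> e" "v \<in> f" "v \<in> A"
    and fin: "finite P" "finite Q"
    and P: "\<And>g. g \<in> E - {e} \<Longrightarrow> g \<inter> P \<noteq> {}" "e \<inter> P = {}"
    and Q: "\<And>g. g \<in> E - {f} \<Longrightarrow> g \<inter> Q \<noteq> {}" "f \<inter> Q = {}"
  shows "\<exists>C. finite C \<and> (\<forall>g\<in>E. g \<inter> C \<noteq> {}) \<and> card C \<le> max (card P) (card Q)"
proof -
  \<comment> \<open>\<open>R\<close> keeps the intersection on side \<open>A\<close> and the union
    on the other side. \<open>S\<close> does the reverse and adds \<open>v\<close>, which alone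
    covers both \<open>e\<close> and \<open>f\<close>.\<close>
  define R where "R = (P \<inter> Q \<inter> A) \<union> ((P \<union> Q) - A)"
  define S where "S = insert v (((P \<union> Q) \<inter> A) \<union> ((P \<inter> Q) - A))"
  obtain x where x: "e = {v, x}" "x \<notin> A" using bip[OF e(1)] e by blast
  obtain y where y: "f = {v, y}" "y \<notin> A" using bip[OF e(2)] e by blast
  \<comment> \<open>\<open>Q\<close> covers \<open>e\<close> but misses \<open>f\<close>, hence
    misses \<open>v\<close>; so it contains the other endpoint of \<open>e\<close>. Symmetrically,
    \<open>P\<close> contains the other endpoint of \<open>f\<close>.\<close>
  have "x \<in> Q" using Q(1)[of e] Q(2) e x y by auto
  have "y \<in> P" using P(1)[of f] P(2) e x y by auto
  have covR: "g \<inter> R \<noteq> {}" if g: "g \<in> E" for g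
  proof -
    obtain a b where ab: "g = {a, b}" "a \<in> A" "b \<notin> A" using bip[OF g] by blast
    show ?thesis
    proof (cases "g = e \<or> g = f")
      case True then show ?thesis using x y \<open>x \<in> Q\<close> \<open>y \<in> P\<close> by (auto simp: R_def)
    next
      case False
      then show ?thesis using P(1)[of g] Q(1)[of g] g ab by (auto simp: R_def)
    qed
  qed
  have covS: "g \<inter> S \<noteq> {}" if g: "g \<in> E" for g
  proof -
    obtain a b where ab: "g = {a, b}" "a \<in> A" "b \<notin> A" using bip[OF g] by blast
    show ?thesis
    proof (cases "g = e \<or> g = f")
      case True then show ?thesis using e by (auto simp: S_def)
    next
      case False
      then show ?thesis using P(1)[of g] Q(1)[of g] g ab by (auto simp: S_def)
    qed
  qed
  have cR: "card R = card (P \<inter> Q \<inter> A) + card ((P \<union> Q) - A)"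
    unfolding R_def using fin by (intro card_Un_disjoint) auto
  have "card S \<le> Suc (card (((P \<union> Q) \<inter> A) \<union> ((P \<inter> Q) - A)))"
    unfolding S_def using fin by (intro card_insert_le_m1) auto
  also have "card (((P \<union> Q) \<inter> A) \<union> ((P \<inter> Q) - A)) = card ((P \<union> Q) \<inter> A) + card ((P \<inter> Q) - A)"
    using fin by (intro card_Un_disjoint) auto
  finally have cS: "card S \<le> Suc (card ((P \<union> Q) \<inter> A) + card ((P \<inter> Q) - A))" .
  have split: "card Z = card (Z \<inter> A) + card (Z - A)" if "finite Z" for Z
    using that by (metis card_Int_Diff)
  have "card (P \<union> Q) + card (P \<inter> Q) = card P + card Q"
    using fin card_Un_Int[of P Q] by simp
  \<comment> \<open>The extra 1 for \<open>v\<close> is harmless: if \<open>R\<close> and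
    \<open>S\<close> both exceeded the maximum, their sizes would add up to at least
    \<open>card P + card Q + 2\<close>.\<close>
  then have "card R + card S \<le> Suc (card P + card Q)"
    using cR cS split[of "P \<union> Q"] split[of "P \<inter> Q"] fin by simp
  then have "card R \<le> max (card P) (card Q) \<or> card S \<le> max (card P) (card Q)"
    by linarith
  moreover have "finite R" "finite S" using fin by (auto simp: R_def S_def)
  ultimately show ?thesis using covR covS by blast
qed

lemma koenig:
  assumes "finite E" "\<And>e. e \<in> E \<Longrightarrow> \<exists>a b. e = {a, b} \<and> a \<in> A \<and> b \<notin> A"
  shows "\<exists>C. finite C \<and> (\<forall>e\<in>E. e \<inter> C \<noteq> {}) \<and> card C \<le> \<mu> E"
  using assms
proof (induction "card E" arbitrary: E rule: less_induct)
  case less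
  note bip = less.prems(2)
  show ?case
  proof (cases "pairwise disjnt E")
    case True
    \<comment> \<open>Pairwise disjoint edges form a matching, so one endpoint of each gives a cover
      of the required size.\<close>
    define g where "g e = (SOME v. v \<in> e)" for e :: "'a set"
    have g: "g e \<in> e" if "e \<in> E" for e
      unfolding g_def using bip[OF that] by (metis insertI1 someI)
    have "matching E E" using True by (simp add: matching_def)
    then have "card (g ` E) \<le> \<mu> E"
      using card_le_matching_number card_image_le less.prems(1) le_trans by metis
    then show ?thesis using g less.prems(1) by (intro exI[of _ "g ` E"]) auto
  next
    case False
    then obtain e f v where ef: "e \<in> E" "f \<in> E" "e \<noteq> f" "v \<in> e" "v \<in> f"
      by (auto simp: pairwise_def disjnt_def)
    have IH: "\<exists>C. finite C \<and> (\<forall>e\<in>E - {h}. e \<inter> C \<noteq> {}) \<and> card C \<le> \<mu> E" if h: "h \<in> E" for h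
    proof -
      obtain C where "finite C" "\<forall>e\<in>E - {h}. e \<inter> C \<noteq> {}" "card C \<le> \<mu> (E - {h})"
        using less.hyps[OF card_Diff1_less[OF less.prems(1) h]] less.prems by (metis Diff_iff finite_Diff)
      moreover have "\<mu> (E - {h}) \<le> \<mu> E" using less.prems(1) by (intro matching_number_mono) auto
      ultimately show ?thesis using le_trans by metis
    qed
    obtain P where P: "finite P" "\<forall>g\<in>E - {e}. g \<inter> P \<noteq> {}" "card P \<le> \<mu> E"
      using IH[OF ef(1)] by blast
    obtain Q where Q: "finite Q" "\<forall>g\<in>E - {f}. g \<inter> Q \<noteq> {}" "card Q \<le> \<mu> E"
      using IH[OF ef(2)] by blast
    consider "e \<inter> P \<noteq> {}" | "f \<inter> Q \<noteq> {}" | "e \<inter> P = {}" "f \<inter> Q = {}" by blast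
    then show ?thesis
    proof cases
      case 1 then show ?thesis using P by (intro exI[of _ P]) blast
    next
      case 2 then show ?thesis using Q by (intro exI[of _ Q]) blast
    next
      case 3
      \<comment> \<open>The shared vertex \<open>v\<close> may lie on either side; complementing
        \<open>A\<close> exchanges the sides.\<close>
      have bip': "\<exists>a b. g = {a, b} \<and> a \<in> -A \<and> b \<notin> -A" if "g \<in> E" for g
        using bip[OF that] by (metis Compl_iff insert_commute)
      have "\<exists>C. finite C \<and> (\<forall>g\<in>E. g \<inter> C \<noteq> {}) \<and> card C \<le> max (card P) (card Q)"
      proof (cases "v \<in> A")
        case True
        show ?thesis by (rule uncross_covers[of E A e f v P Q]) (use bip ef P(1) P(2) Q(1) Q(2) 3 True in \<open>(assumption | blast)+\<close>)
      next
        case False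
        show ?thesis by (rule uncross_covers[of E "-A" e f v P Q]) (use bip' ef P(1) P(2) Q(1) Q(2) 3 False in \<open>(assumption | blast)+\<close>)
      qed
      then show ?thesis using P(3) Q(3) by (meson le_trans max.boundedI)
    qed
  qed
qed

section \<open>Balanced signs\<close>

text \<open>The two signs give opposite cross terms, so the right-hand side is the average of the
  two values and one of them does not exceed it.\<close>

lemma exists_sign:
  fixes c a B :: "'a \<Rightarrow> real"
  shows "\<exists>\<sigma>\<in>{-1, 1}. (\<Sum>v\<in>Y. c v * (B v + \<sigma> * a v)\<^sup>2) \<le> (\<Sum>v\<in>Y. c v * (B v)\<^sup>2) + (\<Sum>v\<in>Y. c v * (a v)\<^sup>2)"
proof -
  define t where "t = (\<Sum>v\<in>Y. 2 * c v * B v * a v)"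
  have eq: "(\<Sum>v\<in>Y. c v * (B v + \<sigma> * a v)\<^sup>2) =
      (\<Sum>v\<in>Y. c v * (B v)\<^sup>2) + (\<Sum>v\<in>Y. c v * (a v)\<^sup>2) + \<sigma> * t" if "\<sigma> \<in> {-1, 1}" for \<sigma>
    unfolding t_def sum_distrib_left sum.distrib[symmetric] using that
    by (intro sum.cong) (auto simp: power2_eq_square algebra_simps)
  show ?thesis
  proof (cases "t \<le> 0")
    case True then show ?thesis using eq[of 1] by auto
  next
    case False then show ?thesis using eq[of "-1"] by auto
  qed
qed

text \<open>A derandomised second-moment bound. For independent random signs, opposite along
  \<open>M\<close>, the signed sum at \<open>v\<close> has variance at most the number of
  \<open>u\<close> with \<open>N v u\<close>. The induction fixes the signs of one matched pair at a
  time, then those of the unmatched vertices, never exceeding the expectation.\<close>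

lemma exists_balanced_signs:
  fixes c :: "'b \<Rightarrow> real" and N :: "'b \<Rightarrow> 'a \<Rightarrow> bool"
  assumes "finite V" "\<And>v. c v \<ge> 0" "pairwise disjnt M" "\<And>e. e \<in> M \<Longrightarrow> e \<subseteq> V \<and> card e = 2"
  shows "\<exists>s :: 'a \<Rightarrow> real. (\<forall>u. s u \<in> {-1, 1}) \<and> (\<forall>e\<in>M. prod s e = -1) \<and>
    (\<Sum>v\<in>Y. c v * (\<Sum>u\<in>V. of_bool (N v u) * s u)\<^sup>2) \<le> (\<Sum>v\<in>Y. c v * (\<Sum>u\<in>V. of_bool (N v u)))"
  using assms(1,3,4)
proof (induction "card V" arbitrary: V M rule: less_induct)
  case less
  let ?A = "\<lambda>v u. of_bool (N v u) :: real"
  show ?case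
  proof (cases "M = {}")
    case True
    show ?thesis
    proof (cases "V = {}")
      case True
      with \<open>M = {}\<close> show ?thesis by (intro exI[of _ "\<lambda>_. 1"]) auto
    next
      case False
      then obtain x where x: "x \<in> V" by blast
      define U where "U = V - {x}"
      have V: "V = insert x U" "x \<notin> U" "finite U" using x less.prems by (auto simp: U_def)
      obtain s where s: "\<forall>u. s u \<in> {-1, 1::real}"
        "(\<Sum>v\<in>Y. c v * (\<Sum>u\<in>U. ?A v u * s u)\<^sup>2) \<le> (\<Sum>v\<in>Y. c v * (\<Sum>u\<in>U. ?A v u))"
        using less.hyps[of U "{}"] V by auto
      obtain \<sigma> :: real where \<sigma>: "\<sigma> \<in> {-1, 1}"
        "(\<Sum>v\<in>Y. c v * ((\<Sum>u\<in>U. ?A v u * s u) + \<sigma> * ?A v x)\<^sup>2) \<le>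
         (\<Sum>v\<in>Y. c v * (\<Sum>u\<in>U. ?A v u * s u)\<^sup>2) + (\<Sum>v\<in>Y. c v * (?A v x)\<^sup>2)"
        using exists_sign[of c "\<lambda>v. \<Sum>u\<in>U. ?A v u * s u" "\<lambda>v. ?A v x" Y] by blast
      have upd: "(\<Sum>u\<in>V. ?A v u * (s(x := \<sigma>)) u) = (\<Sum>u\<in>U. ?A v u * s u) + \<sigma> * ?A v x" for v
      proof -
        have "(\<Sum>u\<in>U. ?A v u * (s(x := \<sigma>)) u) = (\<Sum>u\<in>U. ?A v u * s u)"
          using V by (intro sum.cong) auto
        then show ?thesis using V by (simp add: V(1))
      qed
      have "(\<Sum>v\<in>Y. c v * (\<Sum>u\<in>V. ?A v u)) = (\<Sum>v\<in>Y. c v * (\<Sum>u\<in>U. ?A v u)) + (\<Sum>v\<in>Y. c v * (?A v x)\<^sup>2)"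
        unfolding sum.distrib[symmetric] using V
        by (intro sum.cong) (auto simp: algebra_simps)
      then have "(\<Sum>v\<in>Y. c v * (\<Sum>u\<in>V. ?A v u * (s(x := \<sigma>)) u)\<^sup>2) \<le> (\<Sum>v\<in>Y. c v * (\<Sum>u\<in>V. ?A v u))"
        unfolding upd using \<sigma>(2) s(2) by linarith
      then show ?thesis using s(1) \<sigma>(1) True by (intro exI[of _ "s(x := \<sigma>)"]) auto
    qed
  next
    case False
    then obtain e where e: "e \<in> M" by blast
    then obtain x y where xy: "e = {x, y}" "x \<noteq> y" using less.prems(3) card_2_iff by metis
    define U where "U = V - {x, y}"
    have V: "V = insert x (insert y U)" "x \<notin> U" "y \<notin> U" "finite U"
      using e xy less.prems by (auto simp: U_def)
    have sub: "g \<subseteq> U" if "g \<in> M - {e}" for g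
    proof -
      have "disjnt g e" using that e less.prems(2) by (auto simp: pairwise_def)
      then show ?thesis using less.prems(3)[of g] that xy by (auto simp: U_def disjnt_def)
    qed
    have "card U < card V" using V less.prems(1) by (simp add: xy card_insert_if)
    then obtain s where s: "\<forall>u. s u \<in> {-1, 1::real}" "\<forall>g\<in>M - {e}. prod s g = -1"
      "(\<Sum>v\<in>Y. c v * (\<Sum>u\<in>U. ?A v u * s u)\<^sup>2) \<le> (\<Sum>v\<in>Y. c v * (\<Sum>u\<in>U. ?A v u))"
      using less.hyps[of U "M - {e}"] V sub less.prems by (auto simp: pairwise_def)
    obtain \<sigma> :: real where \<sigma>: "\<sigma> \<in> {-1, 1}"
      "(\<Sum>v\<in>Y. c v * ((\<Sum>u\<in>U. ?A v u * s u) + \<sigma> * (?A v x - ?A v y))\<^sup>2) \<le>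
       (\<Sum>v\<in>Y. c v * (\<Sum>u\<in>U. ?A v u * s u)\<^sup>2) + (\<Sum>v\<in>Y. c v * (?A v x - ?A v y)\<^sup>2)"
      using exists_sign[of c "\<lambda>v. \<Sum>u\<in>U. ?A v u * s u" "\<lambda>v. ?A v x - ?A v y" Y] by blast
    define r where "r = s(x := \<sigma>, y := - \<sigma>)"
    have upd: "(\<Sum>u\<in>V. ?A v u * r u) = (\<Sum>u\<in>U. ?A v u * s u) + \<sigma> * (?A v x - ?A v y)" for v
    proof -
      have "(\<Sum>u\<in>U. ?A v u * r u) = (\<Sum>u\<in>U. ?A v u * s u)"
        using V by (intro sum.cong) (auto simp: r_def)
      then show ?thesis using V xy by (simp add: V(1) r_def algebra_simps)
    qed
    have "(\<Sum>v\<in>Y. c v * (\<Sum>u\<in>V. ?A v u)) = (\<Sum>v\<in>Y. c v * (\<Sum>u\<in>U. ?A v u)) + (\<Sum>v\<in>Y. c v * (?A v x + ?A v y))"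
      unfolding sum.distrib[symmetric] using V xy
      by (intro sum.cong) (auto simp: algebra_simps)
    \<comment> \<open>For 0-1 values the square of a difference is at most the sum: if both vertices
      of the pair count at \<open>v\<close>, their opposite signs cancel.\<close>
    moreover have "(\<Sum>v\<in>Y. c v * (?A v x - ?A v y)\<^sup>2) \<le> (\<Sum>v\<in>Y. c v * (?A v x + ?A v y))"
      using assms(2) by (intro sum_mono mult_left_mono) auto
    ultimately have le: "(\<Sum>v\<in>Y. c v * (\<Sum>u\<in>V. ?A v u * r u)\<^sup>2) \<le> (\<Sum>v\<in>Y. c v * (\<Sum>u\<in>V. ?A v u))"
      unfolding upd using \<sigma>(2) s(3) by linarith
    have "prod r g = -1" if "g \<in> M" for g
    proof (cases "g = e")
      case True then show ?thesis using xy \<sigma>(1) by (auto simp: r_def)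
    next
      case False
      then have "prod r g = prod s g" using sub[of g] that V by (intro prod.cong) (auto simp: r_def)
      then show ?thesis using s(2) that False by auto
    qed
    moreover have "\<forall>u. r u \<in> {-1, 1}" using s(1) \<sigma>(1) by (auto simp: r_def)
    ultimately show ?thesis using le by (intro exI[of _ r]) auto
  qed
qed

section \<open>Edge-degree constrained subgraphs\<close>

text \<open>For signs \<open>s\<close>, the second identity says that the signed count of
  neighbours, multiplied by \<open>s v\<close>, is the number of edges at \<open>v\<close> with
  equal end signs minus the number with opposite ones.\<close>

lemma deg_eq_neighbours:
  assumes "graph V H"
  shows "real (deg H v) = (\<Sum>u\<in>V. of_bool ({u, v} \<in> H))"
    and "(\<Sum>u\<in>V. of_bool ({u, v} \<in> H) * s u) * s v = (\<Sum>e | e \<in> H \<and> v \<in> e. prod s e :: real)"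
proof -
  let ?N = "{u\<in>V. {u, v} \<in> H}"
  have ne: "u \<noteq> v" if "{u, v} \<in> H" for u
    using graph_edge[OF assms that] by auto
  have fV: "finite V" using assms by (simp add: graph_def)
  have bij: "bij_betw (\<lambda>u. {u, v}) ?N {e\<in>H. v \<in> e}"
  proof (intro bij_betwI')
    fix e assume "e \<in> {e\<in>H. v \<in> e}"
    then have e: "e \<in> H" "v \<in> e" by auto
    then obtain x y where "e = {x, y}" "x \<in> V" "y \<in> V"
      using graph_edge[OF assms e(1)] by (auto simp: card_2_iff)
    then show "\<exists>u\<in>?N. e = {u, v}" using e by (auto simp: insert_commute)
  qed (auto simp: doubleton_eq_iff)
  have "real (deg H v) = real (card ?N)"
    using bij_betw_same_card[OF bij] by (simp add: deg_def)
  also have "\<dots> = (\<Sum>u\<in>V. of_bool ({u, v} \<in> H))" using fV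
    by (simp add: sum_of_bool_eq Collect_conj_eq[of "\<lambda>u. u \<in> V"])
  finally show "real (deg H v) = (\<Sum>u\<in>V. of_bool ({u, v} \<in> H))" .
  have "(\<Sum>u\<in>V. of_bool ({u, v} \<in> H) * s u) * s v = (\<Sum>u\<in>?N. s u * s v)"
    using fV unfolding sum_distrib_right by (intro sum.mono_neutral_cong_right) auto
  also have "\<dots> = (\<Sum>u\<in>?N. prod s {u, v})"
    using ne by (intro sum.cong) auto
  also have "\<dots> = (\<Sum>e | e \<in> H \<and> v \<in> e. prod s e)"
    by (rule sum.reindex_bij_betw[OF bij])
  finally show "(\<Sum>u\<in>V. of_bool ({u, v} \<in> H) * s u) * s v = (\<Sum>e | e \<in> H \<and> v \<in> e. prod s e)" .
qed

text \<open>An edge at \<open>v\<close> contributes 2 to the difference if its ends have opposite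
  signs and 0 otherwise. So keeping only the former halves the degree, up to half of the signed
  sum.\<close>

lemma deg_cross:
  assumes "graph V H" "\<And>u. s u \<in> {-1, 1::real}"
  shows "real (deg {e\<in>H. prod s e = -1} v) = (real (deg H v) - (\<Sum>e | e \<in> H \<and> v \<in> e. prod s e)) / 2"
proof -
  have fin: "finite {e\<in>H. v \<in> e}" using graph_finite[OF assms(1)] by auto
  have pm: "prod s e \<in> {-1, 1}" if "finite e" for e
    using that
  proof induction
    case (insert x F)
    then show ?case using assms(2)[of x] by auto
  qed auto
  have "(real (deg H v) - (\<Sum>e | e \<in> H \<and> v \<in> e. prod s e)) = (\<Sum>e | e \<in> H \<and> v \<in> e. 1 - prod s e)"
    unfolding sum_subtractf by (simp add: deg_def)
  also have "\<dots> = (\<Sum>e | e \<in> H \<and> v \<in> e. 2 * of_bool (prod s e = -1))"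
  proof (intro sum.cong refl)
    fix e assume "e \<in> {e\<in>H. v \<in> e}"
    then have "prod s e \<in> {-1, 1}" using pm graph_edge[OF assms(1)] by blast
    then show "1 - prod s e = 2 * of_bool (prod s e = -1)" by auto
  qed
  also have "\<dots> = 2 * real (card {e\<in>{e\<in>H. v \<in> e}. prod s e = -1})"
  proof -
    have "{e\<in>H. v \<in> e} \<inter> {e. prod s e = -1} = {e\<in>{e\<in>H. v \<in> e}. prod s e = -1}" by auto
    then show ?thesis unfolding sum_distrib_left[symmetric] using fin
      by (simp only: sum_of_bool_eq of_nat_eq_iff)
  qed
  also have "{e\<in>{e\<in>H. v \<in> e}. prod s e = -1} = {e \<in> {e\<in>H. prod s e = -1}. v \<in> e}" by auto
  finally show ?thesis by (simp add: deg_def)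
qed

text \<open>The lower bound \<open>b\<close> is kept apart from \<open>\<beta>\<close> because a
  subgraph damaged by deletions satisfies a weaker lower bound. For \<open>b\<close> near
  \<open>\<beta>\<close> and large \<open>\<beta>\<close> the inequality tends to
  \<open>2 * (\<mu> E - \<mu> H) \<le> \<mu> H\<close>, the factor 3/2.\<close>

lemma edcs_approximation_aux:
  fixes \<beta> b :: real
  assumes G: "graph V E" and HE: "H \<subseteq> E" and \<beta>: "\<beta> > 0"
    and up: "\<And>e. e \<in> H \<Longrightarrow> (\<Sum>v\<in>e. real (deg H v)) \<le> \<beta>"
    and low: "\<And>e. e \<in> E - H \<Longrightarrow> b \<le> (\<Sum>v\<in>e. real (deg H v))"
    and b: "\<beta> \<le> 2 * b"
  shows "2 * (real (\<mu> E) - real (\<mu> H)) * (2 * b / \<beta> - 1) \<le> real (\<mu> H) + 8 / sqrt \<beta> * (4 * real (\<mu> H) + real (\<mu> E))"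
proof -
  have fV: "finite V" using G by (simp add: graph_def)
  have GH: "graph V H" using G HE graph_mono by blast
  have fE: "finite E" and fH: "finite H" using G GH graph_finite by auto
  obtain M where M: "matching E M" "card M = \<mu> E"
    using obtain_maximum_matching fE by metis
  have ME: "M \<subseteq> E" and disj: "pairwise disjnt M" using M by (auto simp: matching_def)
  have fM: "finite M" using ME fE finite_subset by blast
  have edge: "finite e \<and> e \<subseteq> V \<and> card e = 2" if "e \<in> E" for e using graph_edge[OF G that] .
  let ?d = "\<lambda>v. real (deg H v)"
  \<comment> \<open>These weights let one averaged deviation bound pay for both errors below: the
    sum of \<open>?d v / \<beta> * \<bar>\<sigma> v\<bar>\<close> in \<open>upper_m\<close> and half
    the sum of \<open>\<bar>\<sigma> w\<bar>\<close> over \<open>W\<close> in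
    \<open>lower_m\<close>.\<close>
  define c where "c v = ?d v / \<beta> + of_bool (v \<in> \<Union>M) / 2" for v
  have c0: "c v \<ge> 0" for v using \<beta> by (simp add: c_def)
  obtain s :: "'a \<Rightarrow> real" where s: "\<And>u. s u \<in> {-1, 1}" "\<And>e. e \<in> M \<Longrightarrow> prod s e = -1"
    and sle: "(\<Sum>v\<in>V. c v * (\<Sum>u\<in>V. of_bool ({u, v} \<in> H) * s u)\<^sup>2) \<le> (\<Sum>v\<in>V. c v * (\<Sum>u\<in>V. of_bool ({u, v} \<in> H)))"
    using exists_balanced_signs[where V = V and c = c and M = M and Y = V and N = "\<lambda>v u. {u, v} \<in> H",
        OF fV c0 disj] ME edge by blast
  define \<sigma> where "\<sigma> v = (\<Sum>e | e \<in> H \<and> v \<in> e. prod s e)" for v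
  have s2: "s v * s v = 1" for v using s(1)[of v] by auto
  have \<sigma>2: "(\<sigma> v)\<^sup>2 = (\<Sum>u\<in>V. of_bool ({u, v} \<in> H) * s u)\<^sup>2" for v
    unfolding \<sigma>_def deg_eq_neighbours(2)[OF GH, symmetric] power_mult_distrib
    by (simp add: power2_eq_square s2)
  have var: "(\<Sum>v\<in>V. c v * (\<sigma> v)\<^sup>2) \<le> (\<Sum>v\<in>V. c v * ?d v)"
    using sle unfolding \<sigma>2 deg_eq_neighbours(1)[OF GH] .
  have d\<beta>: "?d v \<le> \<beta>" for v
  proof (cases "deg H v = 0")
    case True then show ?thesis using \<beta> by simp
  next
    case False
    then obtain e where e: "e \<in> H" "v \<in> e" unfolding deg_def by (metis (no_types, lifting) card.empty ex_in_conv mem_Collect_eq)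
    then have "?d v \<le> (\<Sum>v\<in>e. ?d v)" using graph_edge[OF GH] by (intro member_le_sum) auto
    then show ?thesis using up[OF e(1)] by linarith
  qed
  define \<Gamma> where "\<Gamma> = (\<Sum>v\<in>V. c v)"
  \<comment> \<open>The second moment is at most \<open>\<beta> * \<Gamma>\<close> because degrees
    are at most \<open>\<beta>\<close>. The first moment follows from \<open>2 * \<bar>\<sigma>
    v\<bar> * sqrt \<beta> \<le> (\<sigma> v)\<^sup>2 + \<beta>\<close>.\<close>
  have dev: "(\<Sum>v\<in>V. c v * \<bar>\<sigma> v\<bar>) \<le> sqrt \<beta> * \<Gamma>"
  proof -
    have sq: "sqrt \<beta> > 0" "sqrt \<beta> * sqrt \<beta> = \<beta>" using \<beta> by auto
    have "c v * \<bar>\<sigma> v\<bar> \<le> (c v * (\<sigma> v)\<^sup>2 / sqrt \<beta> + c v * sqrt \<beta>) / 2" for v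
    proof -
      have "0 \<le> (\<bar>\<sigma> v\<bar> - sqrt \<beta>)\<^sup>2" by simp
      then have "2 * \<bar>\<sigma> v\<bar> * sqrt \<beta> \<le> (\<sigma> v)\<^sup>2 + sqrt \<beta> * sqrt \<beta>"
        by (simp add: power2_eq_square algebra_simps)
      then have "\<bar>\<sigma> v\<bar> \<le> ((\<sigma> v)\<^sup>2 / sqrt \<beta> + sqrt \<beta>) / 2" using sq(1) by (simp add: field_simps)
      then have "c v * \<bar>\<sigma> v\<bar> \<le> c v * (((\<sigma> v)\<^sup>2 / sqrt \<beta> + sqrt \<beta>) / 2)" using c0 by (intro mult_left_mono)
      then show ?thesis by (simp add: algebra_simps add_divide_distrib)
    qed
    then have "(\<Sum>v\<in>V. c v * \<bar>\<sigma> v\<bar>) \<le> (\<Sum>v\<in>V. (c v * (\<sigma> v)\<^sup>2 / sqrt \<beta> + c v * sqrt \<beta>) / 2)" by (intro sum_mono)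
    also have "\<dots> = ((\<Sum>v\<in>V. c v * (\<sigma> v)\<^sup>2) / sqrt \<beta> + \<Gamma> * sqrt \<beta>) / 2"
      by (simp add: \<Gamma>_def sum_divide_distrib sum_distrib_right sum.distrib add_divide_distrib)
    also have "\<dots> \<le> ((\<beta> * \<Gamma>) / sqrt \<beta> + \<Gamma> * sqrt \<beta>) / 2"
    proof -
      have "(\<Sum>v\<in>V. c v * ?d v) \<le> (\<Sum>v\<in>V. \<beta> * c v)"
        using d\<beta> c0 by (intro sum_mono) (subst mult.commute, rule mult_right_mono)
      then have "(\<Sum>v\<in>V. c v * (\<sigma> v)\<^sup>2) \<le> \<beta> * \<Gamma>" using var by (simp add: \<Gamma>_def sum_distrib_left)
      then show ?thesis using sq by (intro divide_right_mono add_right_mono) auto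
    qed
    also have "\<dots> = sqrt \<beta> * \<Gamma>"
    proof -
      have "\<beta> * \<Gamma> / sqrt \<beta> = sqrt \<beta> * \<Gamma>" using sq by (metis mult.assoc nonzero_mult_div_cancel_left order_less_irrefl)
      then show ?thesis by simp
    qed
    finally show ?thesis .
  qed
  \<comment> \<open>The degree part of the weights sums to \<open>2 * card H / \<beta>\<close>, at
    most \<open>4 * \<mu> H\<close>; the \<open>2 * \<mu> E\<close> endpoints of \<open>M\<close>
    contribute 1/2 each.\<close>
  have \<Gamma>: "\<Gamma> \<le> 4 * \<mu> H + \<mu> E"
  proof -
    have "(\<Sum>v\<in>V. ?d v) = 2 * real (card H)" using handshake[OF GH] by (metis of_nat_mult of_nat_numeral of_nat_sum)
    moreover have "real (card H) \<le> 2 * \<mu> H * \<beta>"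
    proof -
      have "\<And>v. deg H v \<le> nat \<lfloor>\<beta>\<rfloor>" using d\<beta> by (simp add: le_nat_floor)
      then have "card H \<le> 2 * \<mu> H * nat \<lfloor>\<beta>\<rfloor>" using card_le_matching_number_degree[OF GH] by blast
      then have "real (card H) \<le> real (2 * \<mu> H * nat \<lfloor>\<beta>\<rfloor>)" by (rule of_nat_mono)
      also have "\<dots> = 2 * \<mu> H * real (nat \<lfloor>\<beta>\<rfloor>)" by simp
      also have "\<dots> \<le> 2 * \<mu> H * \<beta>" using \<beta> by (intro mult_left_mono) auto
      finally show ?thesis .
    qed
    moreover have "(\<Sum>v\<in>V. of_bool (v \<in> \<Union>M) / 2 :: real) = \<mu> E"
    proof -
      have "(\<Sum>v\<in>V. of_bool (v \<in> \<Union>M) / 2 :: real) = real (card (V \<inter> \<Union>M)) / 2"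
        using fV by (simp add: sum_divide_distrib[symmetric] sum_of_bool_eq del: Union_iff)
      also have "V \<inter> \<Union>M = \<Union>M" using ME edge by blast
      finally show ?thesis using card_Union_matching[OF G M(1)] M(2) by simp
    qed
    moreover have "\<Gamma> = (\<Sum>v\<in>V. ?d v) / \<beta> + (\<Sum>v\<in>V. of_bool (v \<in> \<Union>M) / 2)"
      unfolding \<Gamma>_def c_def sum.distrib sum_divide_distrib[of _ _ \<beta>] ..
    moreover have "2 * real (card H) / \<beta> \<le> 4 * \<mu> H"
      using \<open>real (card H) \<le> 2 * \<mu> H * \<beta>\<close> \<beta> by (simp add: field_simps)
    ultimately have "\<Gamma> \<le> 4 * real (\<mu> H) + real (\<mu> E)" by (simp only:)
    then show ?thesis by simp
  qed
  define X where "X = {e\<in>H. prod s e = -1}"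
  have XH: "X \<subseteq> H" by (auto simp: X_def)
  have fX: "finite X" using XH fH finite_subset by blast
  have bip: "\<exists>x y. e = {x, y} \<and> x \<in> {v. s v = 1} \<and> y \<notin> {v. s v = 1}" if eX: "e \<in> X" for e
  proof -
    have "card e = 2" using graph_edge[OF GH] eX XH by blast
    then obtain x y where xy: "e = {x, y}" "x \<noteq> y" by (meson card_2_iff)
    have "s x * s y = -1" using eX xy by (simp add: X_def)
    then have "s x = 1 \<and> s y \<noteq> 1 \<or> s y = 1 \<and> s x \<noteq> 1" using s(1)[of x] s(1)[of y] by auto
    moreover have "e = {y, x}" using xy by auto
    ultimately show ?thesis using xy(1) by blast
  qed
  obtain C where C: "finite C" "\<And>e. e \<in> X \<Longrightarrow> e \<inter> C \<noteq> {}" "card C \<le> \<mu> X"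
    using koenig[OF fX bip] by blast
  have C\<mu>: "card C \<le> \<mu> H" using C(3) matching_number_mono[OF fH XH] by linarith
  define M0 where "M0 = {e\<in>M. e \<inter> C = {}}"
  define W where "W = \<Union>M0"
  have M0: "M0 \<subseteq> M" "matching E M0" using M by (auto simp: M0_def matching_def pairwise_def)
  have cardM: "\<mu> E \<le> card M0 + \<mu> H"
  proof -
    have "M = M0 \<union> {e\<in>M. e \<inter> C \<noteq> {}}" by (auto simp: M0_def)
    then have "card M \<le> card M0 + card {e\<in>M. e \<inter> C \<noteq> {}}" by (metis card_Un_le)
    then show ?thesis using card_touched_le[OF disj C(1)] C\<mu> M(2) by linarith
  qed
  have cW: "card W = 2 * card M0" using card_Union_matching[OF G M0(2)] by (simp add: W_def)
  have WC: "W \<inter> C = {}" by (auto simp: W_def M0_def)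
  have WM: "W \<subseteq> \<Union>M" using M0 by (auto simp: W_def)
  have WV: "W \<subseteq> V" using WM ME edge by blast
  have fW: "finite W" using WV fV finite_subset by blast
  \<comment> \<open>An edge of \<open>M\<close> has ends of opposite sign. If it were in
    \<open>H\<close>, it would be in \<open>X\<close> and hence meet the cover
    \<open>C\<close>.\<close>
  have notH: "e \<notin> H" if "e \<in> M0" for e
    using that s(2)[of e] C(2)[of e] by (auto simp: M0_def X_def)
  define L where "L = {e\<in>X. e \<inter> W \<noteq> {}}"
  have LX: "L \<subseteq> X" by (auto simp: L_def)
  have fL: "finite L" using LX fX finite_subset by blast
  \<comment> \<open>\<open>C\<close> covers \<open>X\<close> and is disjoint from \<open>W\<close>,
    so each edge of \<open>X\<close> at \<open>W\<close> joins \<open>W\<close> to \<open>C\<close>.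
    Therefore the \<open>X\<close>-degrees over \<open>W\<close> count each edge of \<open>L\<close>
    once.\<close>
  have Ledge: "\<exists>w z. e = {w, z} \<and> w \<in> W \<and> z \<in> C" if e: "e \<in> L" for e
  proof -
    obtain w where w: "w \<in> e" "w \<in> W" using e by (auto simp: L_def)
    obtain z where z: "z \<in> e" "z \<in> C" using C(2)[of e] e LX by auto
    have "w \<noteq> z" using w z WC by auto
    moreover have "card e = 2" using graph_edge[OF GH] e LX XH by blast
    ultimately have "e = {w, z}" using w z by (auto simp: card_2_iff)
    then show ?thesis using w z by blast
  qed
  have half: "d \<le> 2 * ((d - t) / 2) + \<bar>t\<bar>" "(d - t) / 2 \<le> (d + \<bar>t\<bar>) / 2" for d t :: real
    by (simp_all add: field_simps)
  let ?x = "\<lambda>v. real (deg X v)" and ?l = "\<lambda>v. real (deg L v)"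
  let ?m = "real (card L)"
  have x: "?x v = (?d v - \<sigma> v) / 2" for v
    unfolding X_def \<sigma>_def by (rule deg_cross[OF GH s(1)])
  have m1: "(\<Sum>w\<in>W. ?x w) = ?m"
  proof -
    have "(\<Sum>w\<in>W. card {e\<in>X. w \<in> e}) = (\<Sum>e\<in>X. card {w\<in>W. w \<in> e})"
      unfolding card_eq_sum by (rule sum.swap_restrict[OF fW fX])
    also have "\<dots> = (\<Sum>e\<in>L. card {w\<in>W. w \<in> e})"
      using fX fW by (intro sum.mono_neutral_right) (auto simp: L_def)
    also have "\<dots> = (\<Sum>e\<in>L. 1)"
    proof (intro sum.cong refl)
      fix e assume "e \<in> L"
      then obtain w z where "e = {w, z}" "w \<in> W" "z \<in> C" using Ledge by blast
      then have "{w\<in>W. w \<in> e} = {w}" using WC by auto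
      then show "card {w\<in>W. w \<in> e} = 1" by simp
    qed
    finally show ?thesis by (simp add: deg_def flip: of_nat_sum)
  qed
  \<comment> \<open>The ends of each edge of \<open>M0\<close> have degree sum at least
    \<open>b\<close> in \<open>H\<close>, and about half of it survives in \<open>X\<close>.\<close>
  have lower_m: "b * card M0 / 2 - (\<Sum>w\<in>W. \<bar>\<sigma> w\<bar>) / 2 \<le> ?m"
  proof -
    have "b * card M0 = (\<Sum>e\<in>M0. b)" by simp
    also have "\<dots> \<le> (\<Sum>e\<in>M0. \<Sum>v\<in>e. ?d v)" using low notH M0 ME by (intro sum_mono) auto
    also have "\<dots> = (\<Sum>w\<in>W. ?d w)"
    proof -
      have "sum ?d (\<Union>M0) = (sum \<circ> sum) ?d M0"
      proof (rule sum.Union_disjoint)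
        show "\<forall>e\<in>M0. finite e" using M0(1) ME edge by blast
        have "pairwise disjnt M0" using M0(2) by (simp add: matching_def)
        then show "\<forall>e\<in>M0. \<forall>e'\<in>M0. e \<noteq> e' \<longrightarrow> e \<inter> e' = {}"
          unfolding pairwise_def disjnt_def by blast
      qed
      then show ?thesis unfolding W_def by simp
    qed
    also have "\<dots> \<le> (\<Sum>w\<in>W. 2 * ?x w + \<bar>\<sigma> w\<bar>)"
    proof (intro sum_mono)
      fix w show "?d w \<le> 2 * ?x w + \<bar>\<sigma> w\<bar>" unfolding x by (rule half(1))
    qed
    also have "\<dots> = 2 * ?m + (\<Sum>w\<in>W. \<bar>\<sigma> w\<bar>)" by (simp add: sum.distrib sum_distrib_left[symmetric] m1)
    finally show ?thesis by simp
  qed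
  \<comment> \<open>The sum of squared \<open>L\<close>-degrees is a sum over the edges of
    \<open>L\<close>, each contributing at most about \<open>\<beta> / 2\<close>. Comparing it from
    below with a linear function of the degrees bounds the average degree.\<close>
  have upper_m: "?m \<le> \<beta> / 8 * (card W + card C) + (\<Sum>v\<in>V. ?d v / \<beta> * \<bar>\<sigma> v\<bar>)"
  proof -
    have sub: "e \<subseteq> W \<union> C" if "e \<in> L" for e using Ledge[OF that] by auto
    have fWC: "finite (W \<union> C)" using fW C(1) by auto
    have eV: "\<And>e. e \<in> H \<Longrightarrow> e \<subseteq> V" using GH by (auto simp: graph_def)
    have "(\<Sum>v\<in>W \<union> C. ?l v * 1) = (\<Sum>e\<in>L. \<Sum>v\<in>e. 1)"
      by (rule sum_edges_sum_vertices[symmetric, OF fWC fL sub])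
    also have "\<dots> = (\<Sum>e\<in>L. 2)" using graph_edge[OF GH] LX XH by (intro sum.cong) auto
    finally have tot: "(\<Sum>v\<in>W \<union> C. ?l v) = 2 * ?m" by simp
    have cWC: "card (W \<union> C) = card W + card C" using WC fW C(1) by (simp add: card_Un_disjoint)
    have "\<beta> * ?m - \<beta>\<^sup>2 / 16 * (card W + card C) = (\<Sum>v\<in>W \<union> C. \<beta> / 2 * ?l v - \<beta>\<^sup>2 / 16)"
      unfolding sum_subtractf sum_distrib_left[symmetric] tot by (simp add: cWC algebra_simps)
    also have "\<dots> \<le> (\<Sum>v\<in>W \<union> C. ?l v * ?l v)"
    proof (intro sum_mono)
      fix v
      \<comment> \<open>This is the tangent to the square at \<open>\<beta> / 4\<close>, the largest
        average degree compatible with degree sums \<open>\<beta> / 2\<close>.\<close>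
      have "0 \<le> (?l v - \<beta> / 4)\<^sup>2" by simp
      then show "\<beta> / 2 * ?l v - \<beta>\<^sup>2 / 16 \<le> ?l v * ?l v" by (simp add: power2_eq_square algebra_simps)
    qed
    also have "\<dots> = (\<Sum>e\<in>L. \<Sum>v\<in>e. ?l v)"
      by (rule sum_edges_sum_vertices[symmetric, OF fWC fL sub])
    also have "\<dots> \<le> (\<Sum>e\<in>L. \<Sum>v\<in>e. (?d v + \<bar>\<sigma> v\<bar>) / 2)"
    proof (intro sum_mono)
      fix v
      have "?l v \<le> ?x v" using deg_mono[OF fX LX] by simp
      then show "?l v \<le> (?d v + \<bar>\<sigma> v\<bar>) / 2"
        unfolding x using half(2) order_trans by blast
    qed
    also have "\<dots> = (\<Sum>e\<in>L. (\<Sum>v\<in>e. ?d v)) / 2 + (\<Sum>e\<in>L. \<Sum>v\<in>e. \<bar>\<sigma> v\<bar>) / 2"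
      by (simp add: sum.distrib sum_divide_distrib add_divide_distrib)
    also have "\<dots> \<le> (\<Sum>e\<in>L. \<beta>) / 2 + (\<Sum>e\<in>H. \<Sum>v\<in>e. \<bar>\<sigma> v\<bar>) / 2"
      using up LX XH fH
      by (intro add_mono divide_right_mono sum_mono sum_mono2) (auto intro: sum_nonneg)
    also have "(\<Sum>e\<in>H. \<Sum>v\<in>e. \<bar>\<sigma> v\<bar>) = (\<Sum>v\<in>V. ?d v * \<bar>\<sigma> v\<bar>)"
      by (rule sum_edges_sum_vertices[OF fV fH eV])
    finally have "\<beta> * ?m \<le> \<beta>\<^sup>2 / 8 * (card W + card C) + (\<Sum>v\<in>V. ?d v * \<bar>\<sigma> v\<bar>)"
      by (simp add: algebra_simps)
    then have "?m \<le> (\<beta>\<^sup>2 / 8 * (card W + card C) + (\<Sum>v\<in>V. ?d v * \<bar>\<sigma> v\<bar>)) / \<beta>"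
      using \<beta> by (simp add: field_simps)
    also have "\<dots> = \<beta> / 8 * (card W + card C) + (\<Sum>v\<in>V. ?d v / \<beta> * \<bar>\<sigma> v\<bar>)"
      using \<beta> by (simp add: add_divide_distrib sum_divide_distrib power2_eq_square)
    finally show ?thesis .
  qed
  have "(\<Sum>v\<in>V. c v * \<bar>\<sigma> v\<bar>) \<ge> (\<Sum>v\<in>V. ?d v / \<beta> * \<bar>\<sigma> v\<bar>) + (\<Sum>w\<in>W. \<bar>\<sigma> w\<bar>) / 2"
  proof -
    have "(\<Sum>w\<in>W. \<bar>\<sigma> w\<bar>) / 2 = (\<Sum>w\<in>W. \<bar>\<sigma> w\<bar> / 2)" by (simp add: sum_divide_distrib)
    also have "\<dots> = (\<Sum>w\<in>W. of_bool (w \<in> \<Union>M) / 2 * \<bar>\<sigma> w\<bar>)" using WM by (intro sum.cong) auto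
    also have "\<dots> \<le> (\<Sum>w\<in>V. of_bool (w \<in> \<Union>M) / 2 * \<bar>\<sigma> w\<bar>)" using WV fV by (intro sum_mono2) auto
    finally show ?thesis by (simp add: c_def distrib_right sum.distrib)
  qed
  moreover have "sqrt \<beta> * \<Gamma> \<le> sqrt \<beta> * (4 * \<mu> H + \<mu> E)" using \<Gamma> \<beta> by (intro mult_left_mono) auto
  ultimately have key: "b * card M0 / 2 \<le> \<beta> / 8 * (card W + card C) + sqrt \<beta> * (4 * \<mu> H + \<mu> E)"
    using lower_m upper_m dev by linarith
  have "real (card C) \<le> \<mu> H" "\<beta> > 0" using C\<mu> \<beta> by auto
  then have "\<beta> / 8 * (card W + card C) \<le> \<beta> / 8 * (2 * card M0 + \<mu> H)"
    using cW by (intro mult_left_mono) auto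
  then have "b * card M0 / 2 \<le> \<beta> / 8 * (2 * card M0 + \<mu> H) + sqrt \<beta> * (4 * \<mu> H + \<mu> E)" using key by linarith
  then have "8 / \<beta> * (b * card M0 / 2) \<le> 8 / \<beta> * (\<beta> / 8 * (2 * card M0 + \<mu> H) + sqrt \<beta> * (4 * \<mu> H + \<mu> E))"
    using \<beta> by (intro mult_left_mono) auto
  moreover have "8 / \<beta> * (\<beta> / 8 * A + sqrt \<beta> * Z) = A + 8 / sqrt \<beta> * Z" for A Z
  proof -
    have "8 / \<beta> * (\<beta> / 8 * A + sqrt \<beta> * Z) = A + (8 / \<beta> * sqrt \<beta>) * Z"
      using \<beta> by (simp add: distrib_left)
    also have "8 / \<beta> * sqrt \<beta> = 8 / sqrt \<beta>"
      using \<beta> by (simp add: field_simps)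
    finally show ?thesis .
  qed
  moreover have "8 / \<beta> * (b * card M0 / 2) = 2 * card M0 * (2 * b / \<beta>)" by simp
  ultimately have "2 * card M0 * (2 * b / \<beta>) \<le> 2 * card M0 + \<mu> H + 8 / sqrt \<beta> * (4 * \<mu> H + \<mu> E)"
    by (simp only:)
  then have fin: "2 * card M0 * (2 * b / \<beta> - 1) \<le> \<mu> H + 8 / sqrt \<beta> * (4 * \<mu> H + \<mu> E)"
    by (simp add: right_diff_distrib)
  have "2 * b / \<beta> - 1 \<ge> 0" using b \<beta> by (simp add: field_simps)
  then have "2 * (real (\<mu> E) - real (\<mu> H)) * (2 * b / \<beta> - 1) \<le> 2 * real (card M0) * (2 * b / \<beta> - 1)"
    using cardM by (intro mult_right_mono) auto
  then show ?thesis using fin unfolding of_nat_add of_nat_mult of_nat_numeral by linarith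
qed

text \<open>The constant 64 makes the sampling error \<open>8 / sqrt \<beta>\<close> at most
  \<open>\<eta>\<close>. Together with the loss in \<open>b\<close> this leaves an inequality linear
  in the two matching numbers.\<close>

lemma edcs_approximation:
  fixes \<beta> b \<eta> :: real
  assumes G: "graph V E" and HE: "H \<subseteq> E" and \<beta>: "\<beta> > 0"
    and up: "\<And>e. e \<in> H \<Longrightarrow> (\<Sum>v\<in>e. real (deg H v)) \<le> \<beta>"
    and low: "\<And>e. e \<in> E - H \<Longrightarrow> b \<le> (\<Sum>v\<in>e. real (deg H v))"
    and \<eta>: "0 < \<eta>" "\<eta> \<le> 1/10" and b: "(1 - \<eta>) * \<beta> \<le> b" and \<beta>\<eta>: "64 \<le> \<eta>\<^sup>2 * \<beta>"
  shows "real (\<mu> E) \<le> (3/2 + 9 * \<eta>) * real (\<mu> H)"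
proof (cases "\<mu> E \<le> \<mu> H")
  case True
  then have "real (\<mu> E) \<le> 1 * real (\<mu> H)" by simp
  also have "\<dots> \<le> (3/2 + 9 * \<eta>) * real (\<mu> H)" using \<eta> by (intro mult_right_mono) auto
  finally show ?thesis .
next
  case False
  let ?e = "real (\<mu> E)" and ?h = "real (\<mu> H)"
  have "\<beta> \<le> 2 * ((1 - \<eta>) * \<beta>)" using \<eta> \<beta> by (simp add: field_simps)
  then have "\<beta> \<le> 2 * b" using b by linarith
  note * = edcs_approximation_aux[OF G HE \<beta> up low this]
  have "8 \<le> \<eta> * sqrt \<beta>"
    using real_sqrt_le_mono[OF \<beta>\<eta>] \<eta> by (simp add: real_sqrt_mult real_sqrt_unique)
  then have "8 / sqrt \<beta> \<le> \<eta>" using \<beta> by (simp add: field_simps)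
  then have "8 / sqrt \<beta> * (4 * ?h + ?e) \<le> \<eta> * (4 * ?h + ?e)" by (intro mult_right_mono) auto
  moreover have "1 - 2 * \<eta> \<le> 2 * b / \<beta> - 1" using b \<beta> by (simp add: field_simps)
  then have "2 * (?e - ?h) * (1 - 2 * \<eta>) \<le> 2 * (?e - ?h) * (2 * b / \<beta> - 1)"
    using False by (intro mult_left_mono) auto
  ultimately have "2 * (?e - ?h) * (1 - 2 * \<eta>) \<le> ?h + \<eta> * (4 * ?h + ?e)" using * by linarith
  then have "?e * (2 - 5 * \<eta>) \<le> ?h * 3" by (simp add: algebra_simps)
  \<comment> \<open>The coefficient 9 absorbs the division by \<open>2 - 5 * \<eta>\<close>: the
    product is \<open>3 + 10.5 * \<eta> - 45 * \<eta>\<^sup>2\<close>, and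
    \<open>\<eta> \<le> 1/10\<close> controls the quadratic term.\<close>
  also have "?h * 3 \<le> ?h * ((3/2 + 9 * \<eta>) * (2 - 5 * \<eta>))"
  proof (intro mult_left_mono)
    have "45 * (\<eta> * \<eta>) \<le> 45 * (\<eta> * (1/10))" using \<eta> by (intro mult_left_mono) auto
    then show "3 \<le> (3/2 + 9 * \<eta>) * (2 - 5 * \<eta>)" using \<eta> by (simp add: algebra_simps)
  qed simp
  finally have "?e * (2 - 5 * \<eta>) \<le> ((3/2 + 9 * \<eta>) * ?h) * (2 - 5 * \<eta>)" by (simp only: mult_ac)
  then show ?thesis using \<eta> by (subst (asm) mult_le_cancel_right_pos) auto
qed

text \<open>The 1 stands on the right to avoid truncated subtraction in
  \<open>\<beta> - 1\<close>.\<close>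

definition edcs :: "nat \<Rightarrow> 'a set set \<Rightarrow> 'a set set \<Rightarrow> bool" where
  "edcs \<beta> E H \<longleftrightarrow> H \<subseteq> E \<and> (\<forall>e\<in>H. (\<Sum>v\<in>e. deg H v) \<le> \<beta>) \<and> (\<forall>e\<in>E - H. \<beta> \<le> (\<Sum>v\<in>e. deg H v) + 1)"

lemma deg_le_card: assumes "graph V H" shows "deg H v \<le> card V"
proof -
  have "real (deg H v) \<le> (\<Sum>u\<in>V. 1)"
    unfolding deg_eq_neighbours(1)[OF assms] by (intro sum_mono) auto
  then show ?thesis by simp
qed

lemma edcs_deg_le:
  assumes "graph V E" "edcs \<beta> E H" shows "deg H v \<le> \<beta>"
proof (cases "deg H v = 0")
  case False
  then obtain e where e: "e \<in> H" "v \<in> e"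
    unfolding deg_def by (metis (no_types, lifting) card.empty ex_in_conv mem_Collect_eq)
  then have "finite e" using assms graph_edge by (auto simp: edcs_def)
  then have "deg H v \<le> (\<Sum>v\<in>e. deg H v)" using e by (intro member_le_sum) auto
  then show ?thesis using assms(2) e by (fastforce simp: edcs_def)
qed simp

lemma edcs_card_le:
  assumes "graph V E" "edcs \<beta> E H" shows "card H \<le> card V * \<beta>"
proof -
  have "graph V H" using assms graph_mono by (auto simp: edcs_def)
  then have "2 * card H = (\<Sum>v\<in>V. deg H v)" by (rule handshake[symmetric])
  also have "\<dots> \<le> card V * \<beta>" using sum_bounded_above[of V "deg H" \<beta>] edcs_deg_le[OF assms] by simp
  finally show ?thesis by simp
qed

text \<open>The ends of a missing edge have degree sum at most \<open>2 * card V\<close>, which is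
  below \<open>\<beta> - 1\<close>. So doubling may stop at \<open>2 * card V + 2\<close>.\<close>

lemma edcs_large_bound:
  assumes "graph V E" "edcs \<beta> E H" "2 * card V + 2 \<le> \<beta>" shows "H = E"
proof (rule ccontr)
  assume "H \<noteq> E"
  then obtain e where e: "e \<in> E" "e \<notin> H" "H \<subseteq> E" using assms by (auto simp: edcs_def)
  have "(\<Sum>v\<in>e. deg H v) \<le> card e * card V"
    using deg_le_card[OF graph_mono[OF assms(1) e(3)]] sum_bounded_above[of e "deg H" "card V"] by simp
  moreover have "\<beta> \<le> (\<Sum>v\<in>e. deg H v) + 1" using assms(2) e by (auto simp: edcs_def)
  ultimately show False using graph_edge[OF assms(1) e(1)] assms(3) by simp
qed

text \<open>The vertices of degree at least \<open>\<gamma> / 4\<close> in \<open>K\<close> cover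
  all edges outside \<open>K\<close>, and there are at most \<open>8 * card K / \<gamma>\<close> of
  them. Each lies on at most \<open>\<beta> \<le> 2 * \<gamma>\<close> edges of \<open>H\<close>, so
  \<open>H - K\<close> has at most \<open>16 * card K\<close> edges.\<close>

lemma edcs_card_le_doubling:
  assumes G: "graph V E" and "edcs \<beta> E H" "edcs \<gamma> E K" "\<beta> \<le> 2 * \<gamma>" "2 \<le> \<gamma>"
  shows "card H \<le> 17 * card K"
proof -
  have GK: "graph V K" "graph V H" using assms graph_mono by (auto simp: edcs_def)
  have fin: "finite K" "finite H" "finite V" using GK graph_finite by (auto simp: graph_def)
  define S where "S = {v\<in>V. \<gamma> \<le> 4 * deg K v}"
  have fS: "finite S" using fin by (simp add: S_def)
  have "card S * \<gamma> \<le> (\<Sum>v\<in>S. 4 * deg K v)"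
    using sum_bounded_below[of S \<gamma> "\<lambda>v. 4 * deg K v"] by (simp add: S_def)
  also have "\<dots> \<le> (\<Sum>v\<in>V. 4 * deg K v)" using fin by (intro sum_mono2) (auto simp: S_def)
  also have "\<dots> = 8 * card K" using handshake[OF GK(1)] by (simp add: sum_distrib_left[symmetric])
  finally have S: "card S * \<gamma> \<le> 8 * card K" .
  have touch: "e \<inter> S \<noteq> {}" if e: "e \<in> H - K" for e
  proof
    assume a: "e \<inter> S = {}"
    have eE: "e \<in> E" using e assms(2) by (auto simp: edcs_def)
    then have "4 * deg K v \<le> \<gamma> - 1" if "v \<in> e" for v
      using that a graph_edge[OF G eE] by (fastforce simp: S_def)
    then have "(\<Sum>v\<in>e. 4 * deg K v) \<le> card e * (\<gamma> - 1)"
      using sum_bounded_above[of e "\<lambda>v. 4 * deg K v" "\<gamma> - 1"] by simp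
    moreover have "\<gamma> \<le> (\<Sum>v\<in>e. deg K v) + 1" using assms(3) e eE by (auto simp: edcs_def)
    ultimately show False using graph_edge[OF G eE] assms(5) by (simp add: sum_distrib_left[symmetric])
  qed
  have "card (H - K) \<le> card S * \<beta>"
  proof (rule card_le_cover[OF fS _ touch])
    show "deg (H - K) v \<le> \<beta>" for v
      using deg_mono[OF fin(2), of "H - K" v] edcs_deg_le[OF G assms(2), of v] by simp
  qed (use fin in auto)
  also have "\<dots> \<le> card S * (2 * \<gamma>)" using assms(4) by simp
  also have "\<dots> \<le> 16 * card K" using S by (simp add: mult.commute)
  finally have "card (H - K) \<le> 16 * card K" .
  moreover have "card H \<le> card K + card (H - K)"
    using card_mono[of "K \<union> (H - K)" H] card_Un_le[of K "H - K"] fin by simp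
  ultimately show ?thesis by simp
qed

section \<open>Fault tolerance\<close>

lemma tolerant_subgraph_self:
  assumes "1 \<le> \<alpha>" shows "tolerant_subgraph \<alpha> f E E"
  unfolding tolerant_subgraph_def
  using mult_right_mono[OF assms of_nat_0_le_iff[of "\<mu> (E - F)" for F]] by simp

lemma deg_Diff: "finite H \<Longrightarrow> finite F \<Longrightarrow> deg H v \<le> deg (H - F) v + deg F v"
proof -
  assume fin: "finite H" "finite F"
  have "card {e\<in>H. v \<in> e} \<le> card ({e\<in>H - F. v \<in> e} \<union> {e\<in>F. v \<in> e})"
    using fin by (intro card_mono) auto
  then show ?thesis unfolding deg_def using card_Un_le le_trans by blast
qed

text \<open>Only the few vertices \<open>D\<close> at which \<open>F\<close> removes many edges are harmful: after deleting the other
  edges at \<open>D\<close>, the damaged subgraph still satisfies degree constraints. Because \<open>H\<close> has bounded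
  degree and many more than \<open>f\<close> edges, it keeps a matching that is much larger than \<open>D\<close>.\<close>

lemma edcs_tolerant:
  assumes G: "graph V E" and H: "edcs \<beta> E H" and m: "10 \<le> m" and \<beta>: "64 * m\<^sup>2 \<le> \<beta>"
    and large: "(16 * m\<^sup>2 + 1) * f \<le> card H"
  shows "tolerant_subgraph (3/2 + 10 / real m) f E H"
  unfolding tolerant_subgraph_def
proof (intro conjI allI impI)
  show HE: "H \<subseteq> E" using H by (simp add: edcs_def)
  fix F assume "F \<subseteq> E \<and> finite F \<and> card F \<le> f"
  then have F: "F \<subseteq> E" "finite F" "card F \<le> f" by auto
  have fE: "finite E" and fV: "finite V" using G graph_finite by (auto simp: graph_def)
  have fH: "finite H" using HE fE finite_subset by blast
  have "H - F \<subseteq> E" using HE by blast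
  then have GH: "graph V H" "graph V (H - F)" "graph V F" using graph_mono[OF G] HE F by blast+
  have m0: "real m > 0" using m by simp
  have \<beta>0: "real \<beta> \<ge> 64 * (real m)\<^sup>2" using of_nat_mono[OF \<beta>, where 'a=real] by simp
  have "64 * (real m)\<^sup>2 > 0" using m0 by simp
  then have \<beta>pos: "real \<beta> > 0" using \<beta>0 by linarith
  \<comment> \<open>Two endpoints with deletion degree at most \<open>\<theta>\<close> lose at most
    \<open>\<beta> / (2 * m)\<close> together. With the slack 1 in the definition of
    \<open>edcs\<close> this stays within \<open>\<beta> / m\<close>.\<close>
  define \<theta> where "\<theta> = real \<beta> / (4 * real m)"
  have \<theta>: "\<theta> > 0" using m0 \<beta>pos by (simp add: \<theta>_def)
  define D where "D = {v\<in>V. \<theta> \<le> real (deg F v)}"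
  have fD: "finite D" using fV by (simp add: D_def)
  have cD: "card D * \<theta> \<le> 2 * real f"
  proof -
    have "card D * \<theta> \<le> (\<Sum>v\<in>D. real (deg F v))"
      using sum_bounded_below[of D \<theta> "\<lambda>v. real (deg F v)"] by (simp add: D_def)
    also have "\<dots> \<le> (\<Sum>v\<in>V. real (deg F v))" using fV by (intro sum_mono2) (auto simp: D_def)
    also have "\<dots> = 2 * real (card F)" using handshake[OF GH(3)] by (metis of_nat_mult of_nat_numeral of_nat_sum)
    finally show ?thesis using F(3) by simp
  qed
  \<comment> \<open>The edges of \<open>H - F\<close> at \<open>D\<close> stay in \<open>J\<close>,
    so only the other edges of \<open>E - F\<close> at \<open>D\<close> are dropped. Every edge of
    \<open>J\<close> outside \<open>H - F\<close> avoids \<open>D\<close> and keeps a large degree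
    sum.\<close>
  define J where "J = (H - F) \<union> {e\<in>E - F. e \<inter> D = {}}"
  have JE: "J \<subseteq> E" using HE by (auto simp: J_def)
  have GJ: "graph V J" using graph_mono[OF G JE] .
  have "real (\<mu> J) \<le> (3/2 + 9 * (1 / real m)) * real (\<mu> (H - F))"
  proof (rule edcs_approximation[OF GJ, where \<beta> = "real \<beta>" and b = "(1 - 1 / real m) * real \<beta>"])
    show "H - F \<subseteq> J" by (auto simp: J_def)
  next
    fix e assume e: "e \<in> H - F"
    have "(\<Sum>v\<in>e. deg (H - F) v) \<le> (\<Sum>v\<in>e. deg H v)" using fH by (intro sum_mono deg_mono) auto
    also have "\<dots> \<le> \<beta>" using H e by (auto simp: edcs_def)
    finally show "(\<Sum>v\<in>e. real (deg (H - F) v)) \<le> real \<beta>" by (simp flip: of_nat_sum)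
  next
    fix e assume e: "e \<in> J - (H - F)"
    then have e': "e \<in> E - H" "e \<inter> D = {}" by (auto simp: J_def)
    then have ed: "finite e" "e \<subseteq> V" "card e = 2" using graph_edge[OF G] by auto
    have "real \<beta> \<le> (\<Sum>v\<in>e. real (deg H v)) + 1"
      using H e'(1) unfolding edcs_def by (metis of_nat_sum of_nat_mono of_nat_add of_nat_1)
    also have "(\<Sum>v\<in>e. real (deg H v)) \<le> (\<Sum>v\<in>e. real (deg (H - F) v) + \<theta>)"
    proof (intro sum_mono)
      fix v assume v: "v \<in> e"
      then have "real (deg F v) \<le> \<theta>" using e'(2) ed by (auto simp: D_def)
      moreover have "real (deg H v) \<le> real (deg (H - F) v) + real (deg F v)"
        using deg_Diff[OF fH F(2), of v] by simp
      ultimately show "real (deg H v) \<le> real (deg (H - F) v) + \<theta>" by linarith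
    qed
    also have "\<dots> = (\<Sum>v\<in>e. real (deg (H - F) v)) + 2 * \<theta>" using ed by (simp add: sum.distrib)
    finally have *: "real \<beta> \<le> (\<Sum>v\<in>e. real (deg (H - F) v)) + 2 * \<theta> + 1" by simp
    have "real m * 2 \<le> 64 * (real m)\<^sup>2" using m by (simp add: power2_eq_square)
    then have "real m * 2 \<le> real \<beta>" using \<beta>0 by linarith
    then have "2 * \<theta> + 1 \<le> real \<beta> / real m" using m0 by (simp add: \<theta>_def field_simps)
    then show "(1 - 1 / real m) * real \<beta> \<le> (\<Sum>v\<in>e. real (deg (H - F) v))"
      using * by (simp add: left_diff_distrib)
  next
    show "64 \<le> (1 / real m)\<^sup>2 * real \<beta>" using \<beta>0 m0 by (simp add: field_simps)
  qed (use m m0 \<beta>pos in \<open>auto simp: field_simps\<close>)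
  moreover have "\<mu> (E - F) \<le> \<mu> J + card D"
  proof -
    have "\<mu> (E - F) \<le> \<mu> {e\<in>E - F. e \<inter> D = {}} + card D"
      using fE fD by (intro matching_number_delete_vertices) auto
    also have "\<mu> {e\<in>E - F. e \<inter> D = {}} \<le> \<mu> J"
      using finite_subset[OF JE fE] by (intro matching_number_mono) (auto simp: J_def)
    finally show ?thesis by simp
  qed
  \<comment> \<open>\<open>H - F\<close> keeps at least \<open>16 * m\<^sup>2 * f\<close> edges, so
    \<open>f\<close> is at most \<open>\<mu> (H - F) * \<beta> / (8 * m\<^sup>2)\<close>. Since
    \<open>D\<close> has at most \<open>2 * f / \<theta>\<close> vertices, this gives exactly the
    share \<open>1 / m\<close>, which raises 9 to 10.\<close>
  moreover have "real (card D) \<le> 1 / real m * real (\<mu> (H - F))"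
  proof -
    have "card (H - F) \<le> 2 * \<mu> (H - F) * \<beta>"
      using card_le_matching_number_degree[OF GH(2)] edcs_deg_le[OF G H] deg_mono[OF fH, of "H - F"]
      by (meson Diff_subset le_trans)
    moreover have "card H \<le> card (H - F) + card F"
      using card_mono[of "(H - F) \<union> F" H] card_Un_le[of "H - F" F] fH F(2) by simp
    ultimately have "16 * m\<^sup>2 * f \<le> 2 * \<mu> (H - F) * \<beta>" using large F(3) by (simp add: algebra_simps)
    then have "real (16 * m\<^sup>2 * f) \<le> real (2 * \<mu> (H - F) * \<beta>)" by (rule of_nat_mono)
    then have "16 * (real m)\<^sup>2 * real f \<le> 2 * real (\<mu> (H - F)) * real \<beta>" by simp
    then have "8 * real m * (2 * real f) \<le> 8 * real m * (\<theta> * (1 / real m * real (\<mu> (H - F))))"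
      using m0 by (simp add: \<theta>_def power2_eq_square field_simps)
    then have "2 * real f \<le> \<theta> * (1 / real m * real (\<mu> (H - F)))"
      using m0 by (subst (asm) mult_le_cancel_left_pos) auto
    then have "card D * \<theta> \<le> (1 / real m * real (\<mu> (H - F))) * \<theta>" using cD by (simp add: mult.commute)
    then show ?thesis using \<theta> by (subst (asm) mult_le_cancel_right_pos) auto
  qed
  ultimately have "real (\<mu> (E - F)) \<le> (3/2 + 9 * (1 / real m)) * real (\<mu> (H - F)) + 1 / real m * real (\<mu> (H - F))"
    by linarith
  also have "\<dots> = (3/2 + 10 / real m) * real (\<mu> (H - F))" by (simp add: algebra_simps)
  finally show "real (\<mu> (E - F)) \<le> (3/2 + 10 / real m) * real (\<mu> (H - F))" .
qed

section \<open>Local search\<close>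

text \<open>One test decides whether \<open>e\<close> belongs to the result, for insertion, deletion
  and no change alike. The 2 anticipates the degree sum after an insertion.\<close>

definition adjust :: "nat \<Rightarrow> 'a set set \<Rightarrow> 'a set \<Rightarrow> 'a set set \<Rightarrow> 'a set set" where
  "adjust \<beta> E e H =
    (if e \<in> E \<and> (\<Sum>v\<in>e. deg H v) + (if e \<in> H then 0 else 2) \<le> \<beta> then insert e H else H - {e})"

definition potential :: "nat \<Rightarrow> 'a set \<Rightarrow> 'a set set \<Rightarrow> int" where
  "potential \<beta> V H = (2 * int \<beta> - 1) * int (card H) - (\<Sum>v\<in>V. (int (deg H v))\<^sup>2)"

lemma deg_insert:
  assumes "finite K" "e \<notin> K" shows "deg (insert e K) v = deg K v + of_bool (v \<in> e)"
proof -
  have "{g \<in> insert e K. v \<in> g} = (if v \<in> e then insert e {g\<in>K. v \<in> g} else {g\<in>K. v \<in> g})" by auto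
  then show ?thesis using assms by (auto simp: deg_def)
qed

lemma potential_insert:
  assumes "graph V (insert e K)" "e \<notin> K"
  shows "potential \<beta> V (insert e K) = potential \<beta> V K + 2 * int \<beta> - 3 - 2 * (\<Sum>v\<in>e. int (deg K v))"
    and "(\<Sum>v\<in>e. deg (insert e K) v) = (\<Sum>v\<in>e. deg K v) + 2"
proof -
  have fin: "finite V" "finite K" using assms graph_finite[OF assms(1)] by (auto simp: graph_def)
  have e: "finite e" "e \<subseteq> V" "card e = 2" using graph_edge[OF assms(1), of e] by auto
  have "(\<Sum>v\<in>V. (int (deg (insert e K) v))\<^sup>2) = (\<Sum>v\<in>V. (int (deg K v))\<^sup>2 + of_bool (v \<in> e) * (2 * int (deg K v) + 1))"
    using deg_insert[OF fin(2) assms(2)] by (intro sum.cong) (auto simp: power2_eq_square algebra_simps)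
  also have "\<dots> = (\<Sum>v\<in>V. (int (deg K v))\<^sup>2) + (\<Sum>v\<in>V. of_bool (v \<in> e) * (2 * int (deg K v) + 1))"
    by (rule sum.distrib)
  also have "(\<Sum>v\<in>V. of_bool (v \<in> e) * (2 * int (deg K v) + 1)) = (\<Sum>v\<in>e. 2 * int (deg K v) + 1)"
    using fin e by (intro sum.mono_neutral_cong_right) auto
  also have "\<dots> = 2 * (\<Sum>v\<in>e. int (deg K v)) + 2" using e by (simp add: sum.distrib sum_distrib_left)
  finally show "potential \<beta> V (insert e K) = potential \<beta> V K + 2 * int \<beta> - 3 - 2 * (\<Sum>v\<in>e. int (deg K v))"
    using fin assms(2) by (simp add: potential_def algebra_simps)
  show "(\<Sum>v\<in>e. deg (insert e K) v) = (\<Sum>v\<in>e. deg K v) + 2"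
  proof -
    have "(\<Sum>v\<in>e. deg (insert e K) v) = (\<Sum>v\<in>e. deg K v + 1)"
      by (intro sum.cong refl) (simp add: deg_insert[OF fin(2) assms(2)])
    then show ?thesis unfolding sum.distrib using e by simp
  qed
qed

lemma adjust_subset: "H \<subseteq> E \<Longrightarrow> adjust \<beta> E e H \<subseteq> E"
  by (auto simp: adjust_def)

text \<open>Inserting \<open>e\<close> changes the potential by \<open>2 * \<beta> - 3\<close> minus
  twice the degree sum before insertion. This is odd: at least 1 if that sum is at most
  \<open>\<beta> - 2\<close>, and at most -1 if it is at least \<open>\<beta> - 1\<close>, in which
  case deletion gains.\<close>

lemma adjust_potential:
  assumes "graph V E" "H \<subseteq> E"
  shows "adjust \<beta> E e H = H \<or> potential \<beta> V H < potential \<beta> V (adjust \<beta> E e H)"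
proof (cases "e \<in> H")
  case True
  have "graph V (insert e (H - {e}))" using True assms graph_mono by (metis insert_Diff)
  note * = potential_insert(1)[OF this, of \<beta>] potential_insert(2)[OF this]
  have ins: "insert e (H - {e}) = H" "insert e H = H" using True by auto
  show ?thesis
  proof (cases "(\<Sum>v\<in>e. deg H v) \<le> \<beta>")
    case True then show ?thesis using \<open>e \<in> H\<close> assms by (auto simp: adjust_def)
  next
    case False
    then have "int \<beta> \<le> (\<Sum>v\<in>e. int (deg (H - {e}) v)) + 1"
      using *(2) by (simp add: ins flip: of_nat_sum)
    then show ?thesis using *(1) False True by (simp add: ins adjust_def)
  qed
next
  case False
  show ?thesis
  proof (cases "e \<in> E \<and> (\<Sum>v\<in>e. deg H v) + 2 \<le> \<beta>")
    case True
    then have "graph V (insert e H)" using assms graph_mono by (metis insert_subset)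
    note * = potential_insert(1)[OF this False, of \<beta>]
    have "(\<Sum>v\<in>e. int (deg H v)) + 2 \<le> int \<beta>" using True by (simp flip: of_nat_sum)
    then show ?thesis using * True False by (simp add: adjust_def)
  next
    case a: False
    then show ?thesis using False by (auto simp: adjust_def)
  qed
qed

text \<open>Together with \<open>edcs_if_stable\<close>, this identifies the constrained subgraphs
  with the fixed points of \<open>adjust\<close>. Surplus sweeps are therefore harmless and the
  number of sweeps can be fixed in advance.\<close>

lemma edcs_adjust: "edcs \<beta> E H \<Longrightarrow> adjust \<beta> E e H = H"
  unfolding edcs_def adjust_def by (cases "e \<in> H"; cases "e \<in> E") (auto dest!: bspec[of "E - H" _ e])

lemma edcs_if_stable:
  assumes "H \<subseteq> E" "\<And>e. e \<in> E \<Longrightarrow> adjust \<beta> E e H = H" shows "edcs \<beta> E H"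
  unfolding edcs_def
proof (intro conjI ballI assms(1))
  fix e assume e: "e \<in> H"
  show "(\<Sum>v\<in>e. deg H v) \<le> \<beta>"
  proof (rule ccontr)
    assume "\<not> ?thesis"
    then have "adjust \<beta> E e H = H - {e}" using e by (simp add: adjust_def)
    then show False using assms(1) assms(2)[of e] e by blast
  qed
next
  fix e assume e: "e \<in> E - H"
  show "\<beta> \<le> (\<Sum>v\<in>e. deg H v) + 1"
  proof (rule ccontr)
    assume "\<not> ?thesis"
    then have "adjust \<beta> E e H = insert e H" using e by (simp add: adjust_def)
    then show False using assms(2)[of e] e by blast
  qed
qed

definition sweep :: "nat \<Rightarrow> 'a set set \<Rightarrow> 'a set list \<Rightarrow> 'a set set \<Rightarrow> 'a set set" where
  "sweep \<beta> E es = fold (adjust \<beta> E) es"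

lemma sweep_subset: "H \<subseteq> E \<Longrightarrow> sweep \<beta> E es H \<subseteq> E"
  unfolding sweep_def by (induction es arbitrary: H) (auto simp: adjust_subset)

lemma sweep_iter_subset: "H \<subseteq> E \<Longrightarrow> (sweep \<beta> E es ^^ k) H \<subseteq> E"
  by (induction k) (auto simp: sweep_subset)

lemma edcs_sweep: "edcs \<beta> E H \<Longrightarrow> sweep \<beta> E es H = H"
  unfolding sweep_def by (induction es) (auto simp: edcs_adjust)

lemma edcs_sweep_iter: "edcs \<beta> E H \<Longrightarrow> (sweep \<beta> E es ^^ k) H = H"
  by (induction k) (auto simp: edcs_sweep)

text \<open>No step lowers the potential and every actual change raises it, so changes within a
  sweep cannot cancel.\<close>

lemma sweep_potential:
  assumes "graph V E" "H \<subseteq> E"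
  shows "(\<forall>e\<in>set es. adjust \<beta> E e H = H) \<and> sweep \<beta> E es H = H \<or> potential \<beta> V H < potential \<beta> V (sweep \<beta> E es H)"
  using assms(2)
proof (induction es arbitrary: H)
  case (Cons e es)
  have "adjust \<beta> E e H \<subseteq> E" using Cons.prems by (rule adjust_subset)
  note IH = Cons.IH[OF this]
  have step: "sweep \<beta> E (e # es) H = sweep \<beta> E es (adjust \<beta> E e H)" by (simp add: sweep_def)
  show ?case
  proof (cases "adjust \<beta> E e H = H")
    case True
    then show ?thesis using IH by (simp add: step)
  next
    case False
    then have "potential \<beta> V H < potential \<beta> V (adjust \<beta> E e H)"
      using adjust_potential[OF assms(1) Cons.prems] by blast
    then show ?thesis unfolding step using IH by (metis order_less_trans)
  qed
qed (simp add: sweep_def)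

lemma sweep_iter_potential:
  assumes "graph V E" "H \<subseteq> E" "E \<subseteq> set es"
  shows "edcs \<beta> E ((sweep \<beta> E es ^^ k) H) \<or> potential \<beta> V H + int k \<le> potential \<beta> V ((sweep \<beta> E es ^^ k) H)"
proof (induction k)
  case (Suc k)
  let ?K = "(sweep \<beta> E es ^^ k) H"
  have K: "?K \<subseteq> E" using assms(2) by (rule sweep_iter_subset)
  show ?case
  proof (cases "edcs \<beta> E ?K")
    case True then show ?thesis by (simp add: edcs_sweep)
  next
    case False
    then have "potential \<beta> V ?K < potential \<beta> V (sweep \<beta> E es ?K)"
      using sweep_potential[OF assms(1) K, of es \<beta>] edcs_if_stable[OF K] assms(3) by blast
    then show ?thesis using Suc False by auto
  qed
qed simp

lemma potential_lower:
  assumes "graph V H" "1 \<le> \<beta>" shows "- (int (card V) ^ 3) \<le> potential \<beta> V H"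
proof -
  have "(\<Sum>v\<in>V. (int (deg H v))\<^sup>2) \<le> (\<Sum>v\<in>V. (int (card V))\<^sup>2)"
    using deg_le_card[OF assms(1)] by (intro sum_mono power_mono) auto
  then have "(\<Sum>v\<in>V. (int (deg H v))\<^sup>2) \<le> int (card V) ^ 3" by (simp add: power2_eq_square power3_eq_cube)
  moreover have "0 \<le> (2 * int \<beta> - 1) * int (card H)" using assms(2) by simp
  ultimately show ?thesis unfolding potential_def by linarith
qed

lemma potential_upper:
  assumes "graph V H" shows "potential \<beta> V H \<le> int \<beta> * (int (card V))\<^sup>2"
proof -
  have "2 * card H \<le> card V * card V"
    using handshake[OF assms] sum_bounded_above[of V "deg H" "card V"] deg_le_card[OF assms] by simp
  then have "int \<beta> * int (2 * card H) \<le> int \<beta> * int (card V * card V)"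
    by (intro mult_left_mono) (simp_all only: of_nat_le_iff of_nat_0_le_iff)
  moreover have "0 \<le> (\<Sum>v\<in>V. (int (deg H v))\<^sup>2)" by (intro sum_nonneg) auto
  ultimately show ?thesis unfolding potential_def by (simp add: power2_eq_square algebra_simps)
qed

text \<open>With \<open>n = card V\<close>, the potential lies between \<open>- (n ^ 3)\<close> and
  \<open>(2 * n + 2) * n\<^sup>2\<close>. Each sweep of an unstable graph gains at least 1, so more
  than \<open>3 * n ^ 3 + 2 * n\<^sup>2\<close> sweeps suffice.\<close>

lemma sweep_iter_edcs:
  assumes "graph V E" "H \<subseteq> E" "E \<subseteq> set es" "1 \<le> \<beta>" "\<beta> \<le> 2 * card V + 2"
  shows "edcs \<beta> E ((sweep \<beta> E es ^^ ((3 * card V + 3) * card V * card V + 1)) H)"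
proof (rule ccontr)
  let ?n = "int (card V)"
  let ?k = "(3 * card V + 3) * card V * card V + 1"
  let ?K = "(sweep \<beta> E es ^^ ?k) H"
  assume "\<not> edcs \<beta> E ?K"
  then have "potential \<beta> V H + int ?k \<le> potential \<beta> V ?K" using sweep_iter_potential[OF assms(1-3), of \<beta> ?k] by blast
  also have "\<dots> \<le> int \<beta> * ?n\<^sup>2"
    using graph_mono[OF assms(1) sweep_iter_subset[OF assms(2)]] by (rule potential_upper)
  also have "\<dots> \<le> (2 * ?n + 2) * ?n\<^sup>2" using assms(5) by (intro mult_right_mono) auto
  finally have "potential \<beta> V H + int ?k \<le> (2 * ?n + 2) * ?n\<^sup>2" .
  moreover have "- (?n ^ 3) \<le> potential \<beta> V H"
    using graph_mono[OF assms(1,2)] assms(4) by (rule potential_lower)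
  ultimately have "int ?k \<le> (2 * ?n + 2) * ?n\<^sup>2 + ?n ^ 3" by linarith
  then have "?n * ?n + 1 \<le> 0"
    by (simp add: power2_eq_square power3_eq_cube algebra_simps)
  moreover have "0 \<le> ?n * ?n" by simp
  ultimately show False by linarith
qed

section \<open>Choosing the degree bound\<close>

text \<open>The returned bound is the one for the next round, whereas the returned graph belongs to
  the old bound; they match only if the bound did not change.\<close>

definition refine :: "nat \<Rightarrow> nat \<Rightarrow> 'a set set \<Rightarrow> 'a set list \<Rightarrow> nat \<times> 'a set set \<Rightarrow> nat \<times> 'a set set" where
  "refine n B E es = (\<lambda>(\<beta>, H). let K = (sweep \<beta> E es ^^ ((3 * n + 3) * n * n + 1)) H in
    (if card K < B then min (2 * \<beta>) (2 * n + 2) else \<beta>, K))"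

lemma refine_result:
  fixes V :: "'a set"
  assumes G: "graph V E" and es: "E \<subseteq> set es" and \<gamma>: "2 \<le> \<gamma>"
  defines "n \<equiv> card V"
  obtains \<beta> H where "(refine n B E es ^^ (2 * n + 3)) (min \<gamma> (2 * n + 2), {}) = (\<beta>, H)"
    "edcs \<beta> E H" "B \<le> card H \<and> \<gamma> \<le> \<beta> \<or> H = E" "card H \<le> n * \<gamma> + 17 * B"
proof -
  \<comment> \<open>Settled pairs are fixed points of \<open>refine\<close>.\<close>
  define settled where "settled \<beta> H \<longleftrightarrow> edcs \<beta> E H \<and> (B \<le> card H \<or> \<beta> = 2 * n + 2)" for \<beta> and H :: "'a set set"
  \<comment> \<open>This records why \<open>\<beta>\<close> is not too large: beyond
    \<open>\<gamma>\<close> it was obtained by doubling a bound whose subgraph had fewer than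
    \<open>B\<close> edges, so \<open>edcs_card_le_doubling\<close> applies.\<close>
  define reached where "reached \<beta> \<longleftrightarrow> \<beta> \<le> \<gamma> \<or>
    (\<exists>\<beta>' K. edcs \<beta>' E K \<and> \<beta> \<le> 2 * \<beta>' \<and> 2 \<le> \<beta>' \<and> card K < B)" for \<beta>
  \<comment> \<open>Until the pair is settled, \<open>\<beta>\<close> grows by at least 1 per round,
    whence \<open>j \<le> \<beta>\<close>. As \<open>\<beta> \<le> 2 * n + 2\<close>, the pair is
    settled after \<open>2 * n + 3\<close> rounds.\<close>
  define inv where "inv j \<beta> H \<longleftrightarrow> H \<subseteq> E \<and> min \<gamma> (2 * n + 2) \<le> \<beta> \<and> \<beta> \<le> 2 * n + 2 \<and> reached \<beta> \<and>
    (settled \<beta> H \<or> j \<le> \<beta>)" for j \<beta> and H :: "'a set set"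
  have inv: "\<exists>\<beta> H. (refine n B E es ^^ j) (min \<gamma> (2 * n + 2), {}) = (\<beta>, H) \<and> inv j \<beta> H" for j
  proof (induction j)
    case 0
    show ?case by (auto simp: inv_def reached_def)
  next
    case (Suc j)
    then obtain \<beta> H where it: "(refine n B E es ^^ j) (min \<gamma> (2 * n + 2), {}) = (\<beta>, H)" and I: "inv j \<beta> H" by blast
    define K where "K = (sweep \<beta> E es ^^ ((3 * n + 3) * n * n + 1)) H"
    have \<beta>2: "2 \<le> \<beta>" using I \<gamma> by (auto simp: inv_def)
    have K: "edcs \<beta> E K"
      using sweep_iter_edcs[OF G _ es, of H \<beta>] I \<beta>2 unfolding K_def n_def[symmetric] inv_def by simp
    have KE: "K \<subseteq> E" using K by (simp add: edcs_def)
    have step: "(refine n B E es ^^ Suc j) (min \<gamma> (2 * n + 2), {}) =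
        (if card K < B then min (2 * \<beta>) (2 * n + 2) else \<beta>, K)"
    proof -
      have "refine n B E es (\<beta>, H) = (if card K < B then min (2 * \<beta>) (2 * n + 2) else \<beta>, K)"
        by (simp only: refine_def Let_def K_def prod.case)
      then show ?thesis using it by (simp only: funpow.simps(2) o_apply)
    qed
    show ?case
    proof (cases "card K < B \<and> \<beta> < 2 * n + 2")
      case True
      have "reached (min (2 * \<beta>) (2 * n + 2))"
        unfolding reached_def using K True \<beta>2 by (intro disjI2 exI[of _ \<beta>] exI[of _ K]) auto
      moreover have "\<not> settled \<beta> H"
      proof
        assume s: "settled \<beta> H"
        then have "K = H" unfolding K_def settled_def using edcs_sweep_iter by blast
        then show False using s True by (simp add: settled_def)
      qed
      then have "j \<le> \<beta>" using I by (simp add: inv_def)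
      ultimately show ?thesis using step True I KE \<beta>2 by (auto simp: inv_def)
    next
      case False
      then have "settled \<beta> K" using K I by (auto simp: settled_def inv_def)
      then show ?thesis using step False I KE by (auto simp: inv_def)
    qed
  qed
  obtain \<beta> H where it: "(refine n B E es ^^ (2 * n + 3)) (min \<gamma> (2 * n + 2), {}) = (\<beta>, H)"
    and I: "inv (2 * n + 3) \<beta> H" using inv by blast
  then have H: "settled \<beta> H" by (auto simp: inv_def)
  then have ed: "edcs \<beta> E H" by (simp add: settled_def)
  have full: "H = E" if "\<beta> = 2 * n + 2" using edcs_large_bound[OF G ed] that by (simp add: n_def)
  have alt: "B \<le> card H \<and> \<gamma> \<le> \<beta> \<or> H = E"
  proof (cases "\<beta> = 2 * n + 2")
    case False
    then show ?thesis using H I by (auto simp: settled_def inv_def min_def split: if_splits)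
  qed (use full in auto)
  have "card H \<le> n * \<gamma> + 17 * B"
  proof (cases "\<beta> \<le> \<gamma>")
    case True
    have "card H \<le> n * \<beta>" using edcs_card_le[OF G ed] by (simp add: n_def)
    also have "\<dots> \<le> n * \<gamma>" using True by simp
    finally show ?thesis by simp
  next
    case False
    then obtain \<beta>' K where "edcs \<beta>' E K" "\<beta> \<le> 2 * \<beta>'" "2 \<le> \<beta>'" "card K < B"
      using I by (auto simp: inv_def reached_def)
    then show ?thesis using edcs_card_le_doubling[OF G ed, of \<beta>' K] by simp
  qed
  then show thesis using that it ed alt by blast
qed

text \<open>With \<open>m = 10 * N\<close> the excess \<open>10 / m\<close> is \<open>1 / N\<close>.
  The choice of \<open>N\<close> makes \<open>1 / N\<close> at most
  \<open>p / q \<le> \<epsilon>\<close>, while \<open>\<epsilon> / 2 \<le> p / q\<close> keeps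
  \<open>N\<close> of order \<open>1 / \<epsilon>\<close> for small
  \<open>\<epsilon>\<close>.\<close>

lemma refine_tolerant:
  fixes V :: "'a set"
  assumes G: "graph V E" and es: "E \<subseteq> set es" and \<epsilon>: "\<epsilon> > 0" and pq: "represents p q \<epsilon>"
  defines "n \<equiv> card V" and "m \<equiv> 10 * (q div p + 1)"
  obtains \<beta> H where "(refine n ((16 * m\<^sup>2 + 1) * f) E es ^^ (2 * n + 3)) (min (64 * m\<^sup>2) (2 * n + 2), {}) = (\<beta>, H)"
    "H \<subseteq> E" "tolerant_subgraph (3/2 + \<epsilon>) f E H"
    "real (card H) \<le> 200000 * ((real n * ln (1 / min \<epsilon> (1/2)) + real f) / (min \<epsilon> (1/2))\<^sup>2)"
proof -
  let ?B = "(16 * m\<^sup>2 + 1) * f"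
  define \<delta> where "\<delta> = min \<epsilon> (1/2)"
  have \<delta>: "\<delta> > 0" "\<delta> \<le> 1/2" "\<delta> \<le> \<epsilon>" using \<epsilon> by (auto simp: \<delta>_def)
  have pos: "real p / real q > 0" using pq \<epsilon> unfolding represents_def by linarith
  then have pq0: "p > 0" "q > 0" by (auto simp: zero_less_divide_iff)
  define N where "N = q div p + 1"
  have "q < N * p" using pq0 by (metis N_def Suc_eq_plus1 dividend_less_times_div mult.commute mult_Suc_right)
  then have "real q < real N * real p" by (metis of_nat_less_iff of_nat_mult)
  then have "1 / real N \<le> real p / real q" using pq0 by (simp add: N_def field_simps)
  then have N1: "1 / real N \<le> \<epsilon>" using pq by (simp add: represents_def)
  have N2: "real N \<le> 5/2 / \<delta>"
  proof -
    have "real N \<le> real q / real p + 1" using of_nat_div_le_of_nat[of q p, where 'a=real] by (simp add: N_def)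
    moreover have "real q / real p \<le> 2 / \<epsilon>" using pq pq0 \<epsilon> by (auto simp: represents_def field_simps)
    moreover have "2 / \<epsilon> \<le> 2 / \<delta>" using \<delta> \<epsilon> by (intro divide_left_mono) auto
    moreover have "1 \<le> (1/2) / \<delta>" using \<delta> by (simp add: field_simps)
    moreover have "2 / \<delta> + (1/2) / \<delta> = 5/2 / \<delta>" unfolding add_divide_distrib[symmetric] by simp
    ultimately show ?thesis by linarith
  qed
  have m: "m = 10 * N" by (simp add: m_def N_def)
  have m10: "10 \<le> m" by (simp add: m_def)
  then have "10\<^sup>2 \<le> m\<^sup>2" by (intro power_mono) auto
  then have m2: "2 \<le> 64 * m\<^sup>2" "1 \<le> m\<^sup>2" by auto
  obtain \<beta> H where it: "(refine n ?B E es ^^ (2 * n + 3)) (min (64 * m\<^sup>2) (2 * n + 2), {}) = (\<beta>, H)"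
    and H: "edcs \<beta> E H" "?B \<le> card H \<and> 64 * m\<^sup>2 \<le> \<beta> \<or> H = E" "card H \<le> n * (64 * m\<^sup>2) + 17 * ?B"
    using refine_result[OF G es m2(1), of ?B] unfolding n_def[symmetric] by metis
  have "tolerant_subgraph (3/2 + 10 / real m) f E H"
    using H(2)
  proof
    assume "?B \<le> card H \<and> 64 * m\<^sup>2 \<le> \<beta>"
    then show ?thesis using edcs_tolerant[OF G H(1) m10] by blast
  next
    assume "H = E"
    moreover have "0 \<le> 10 / real m" by simp
    then have "1 \<le> 3/2 + 10 / real m" by linarith
    ultimately show ?thesis using tolerant_subgraph_self by blast
  qed
  moreover have "10 / real m \<le> \<epsilon>" using N1 by (simp add: m)
  ultimately have tol: "tolerant_subgraph (3/2 + \<epsilon>) f E H"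
    unfolding tolerant_subgraph_def by (meson add_left_mono mult_right_mono of_nat_0_le_iff order_trans)
  \<comment> \<open>The summand 1 is absorbed into \<open>17 * m\<^sup>2\<close>, so the coefficient
    of \<open>f\<close> becomes 17 * 17 = 289.\<close>
  have "17 * ?B \<le> 17 * ((17 * m\<^sup>2) * f)" using m2(2) by (intro mult_left_mono mult_right_mono) auto
  also have "\<dots> = 289 * m\<^sup>2 * f" by simp
  finally have "n * (64 * m\<^sup>2) + 17 * ?B \<le> 64 * m\<^sup>2 * n + 289 * m\<^sup>2 * f" by simp
  then have "card H \<le> 64 * m\<^sup>2 * n + 289 * m\<^sup>2 * f" using H(3) le_trans by blast
  then have "real (card H) \<le> real (64 * m\<^sup>2 * n + 289 * m\<^sup>2 * f)" by (rule of_nat_mono)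
  also have "\<dots> = (real m)\<^sup>2 * (64 * real n + 289 * real f)" by (simp add: algebra_simps)
  also have "\<dots> \<le> (625 / \<delta>\<^sup>2) * (64 * (real n * (2 * ln (1 / \<delta>))) + 289 * real f)"
  proof (intro mult_mono add_mono mult_left_mono)
    have "real m \<le> 25 / \<delta>" using N2 by (simp add: m)
    then have "(real m)\<^sup>2 \<le> (25 / \<delta>)\<^sup>2" by (intro power_mono) auto
    then show "(real m)\<^sup>2 \<le> 625 / \<delta>\<^sup>2" by (simp add: power_divide)
    \<comment> \<open>As \<open>\<delta> \<le> 1/2\<close>, the logarithm of
      \<open>1 / \<delta>\<close> is at least 1/2, so a factor \<open>2 * ln (1 / \<delta>)\<close>
      may be inserted next to \<open>n\<close>.\<close>
    have "ln \<delta> \<le> \<delta> - 1" using \<delta>(1) by (rule ln_le_minus_one)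
    then have "1 \<le> 2 * ln (1 / \<delta>)" using \<delta> by (simp only: ln_div ln_one) simp
    then have "real n * 1 \<le> real n * (2 * ln (1 / \<delta>))" by (intro mult_left_mono) auto
    then show "real n \<le> real n * (2 * ln (1 / \<delta>))" by simp
  qed (use \<delta> in auto)
  also have "\<dots> = (80000 * (real n * ln (1 / \<delta>)) + 180625 * real f) / \<delta>\<^sup>2"
    by (simp add: algebra_simps add_divide_distrib)
  also have "\<dots> \<le> (200000 * (real n * ln (1 / \<delta>)) + 200000 * real f) / \<delta>\<^sup>2"
  proof -
    have "0 \<le> ln (1 / \<delta>)" using \<delta> by (intro ln_ge_zero) (simp add: field_simps)
    then have "0 \<le> real n * ln (1 / \<delta>)" by simp
    then show ?thesis by (intro divide_right_mono add_mono mult_right_mono) auto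
  qed
  also have "\<dots> = 200000 * ((real n * ln (1 / \<delta>) + real f) / \<delta>\<^sup>2)" by (simp add: distrib_left)
  finally show thesis using that[OF it _ tol] H(1) unfolding \<delta>_def by (simp add: edcs_def)
qed

section \<open>Total correctness with running time\<close>

lemma bits_le_iff: "bits x \<le> k \<longleftrightarrow> x < 2 ^ k"
  using floorlog_leI[of x 2 k] floorlog_leD[of 2 x k] by auto

definition bounded_cells :: "nat \<Rightarrow> state \<Rightarrow> bool" where
  "bounded_cells L s \<longleftrightarrow> (\<forall>x i. s x i < 2 ^ L)"

text \<open>When all cells are below \<open>2 ^ L\<close>, value lengths are at most
  \<open>val_weight\<close> times \<open>L + 1\<close>, and costs at most \<open>cost_weight\<close>
  times \<open>L + 1\<close>. A cell has weight 1 whatever its address.\<close>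

primrec val_weight :: "exp \<Rightarrow> nat" where
  "val_weight (Const k) = bits k"
| "val_weight (Cell x e) = 1"
| "val_weight (Op b e1 e2) = val_weight e1 + val_weight e2 + 1"

primrec cost_weight :: "exp \<Rightarrow> nat" where
  "cost_weight (Const k) = 1 + bits k"
| "cost_weight (Cell x e) = 2 + cost_weight e"
| "cost_weight (Op b e1 e2) = 1 + cost_weight e1 + cost_weight e2 + val_weight (Op b e1 e2)"

text \<open>Even multiplication only adds lengths, so intermediate values need no individual bounds;
  only stored values must be below \<open>2 ^ L\<close>.\<close>

lemma bits_apply_bop: "bits (apply_bop b x y) \<le> bits x + bits y + 1"
proof -
  have x: "x < 2 ^ bits x" and y: "y < 2 ^ bits y" using bits_le_iff by blast+
  have le: "(2::nat) ^ bits x \<le> 2 ^ (bits x + bits y)" "(2::nat) ^ bits y \<le> 2 ^ (bits x + bits y)"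
    by (intro power_increasing; simp)+
  have "apply_bop b x y < 2 ^ (bits x + bits y + 1)"
  proof (cases b)
    case Add
    have "x + y < 2 ^ bits x + 2 ^ bits y" using x y by (rule add_strict_mono)
    also have "\<dots> \<le> 2 ^ (bits x + bits y) + 2 ^ (bits x + bits y)" using le by (rule add_mono)
    finally show ?thesis using Add by simp
  next
    case Sub
    have "x - y \<le> x" by simp
    then have "x - y < 2 ^ (bits x + bits y)" using x le(1) by linarith
    then show ?thesis using Sub by simp
  next
    case Mul
    have "x * y \<le> 2 ^ bits x * 2 ^ bits y" using x y by (intro mult_mono) auto
    moreover have "(0::nat) < 2 ^ bits x * 2 ^ bits y" by simp
    ultimately have "x * y < 2 ^ bits x * 2 ^ bits y * 2" by linarith
    then show ?thesis using Mul by (simp add: power_add)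
  next
    case Div
    have "x div y \<le> x" by simp
    then have "x div y < 2 ^ (bits x + bits y)" using x le(1) by linarith
    then show ?thesis using Div by simp
  next
    case Less
    then have "apply_bop b x y \<le> 1" by simp
    also have "(1::nat) < 2 ^ (bits x + bits y + 1)" by (rule one_less_power) auto
    finally show ?thesis .
  qed
  then show ?thesis unfolding bits_le_iff .
qed

lemma bits_val_le: "bounded_cells L s \<Longrightarrow> bits (val e s) \<le> val_weight e * (L + 1)"
proof (induction e)
  case (Const k)
  then show ?case by simp
next
  case (Cell x e)
  then have "bits (s x (val e s)) \<le> L" by (simp add: bounded_cells_def bits_le_iff)
  then show ?case by simp
next
  case (Op b e1 e2)
  then show ?case using bits_apply_bop[of b "val e1 s" "val e2 s"] by (simp add: algebra_simps)
qed

lemma cost_le: "bounded_cells L s \<Longrightarrow> cost e s \<le> cost_weight e * (L + 1)"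
proof (induction e)
  case (Const k)
  then show ?case by simp
next
  case (Cell x e)
  then have "bits (s x (val e s)) \<le> L" by (simp add: bounded_cells_def bits_le_iff)
  then show ?case using Cell by (simp add: algebra_simps)
next
  case (Op b e1 e2)
  have "cost (Op b e1 e2) s = 1 + cost e1 s + cost e2 s + bits (val (Op b e1 e2) s)" by simp
  also have "\<dots> \<le> (L + 1) + cost_weight e1 * (L + 1) + cost_weight e2 * (L + 1) + val_weight (Op b e1 e2) * (L + 1)"
    using Op.IH[OF Op.prems] bits_val_le[OF Op.prems, of "Op b e1 e2"] by (intro add_mono) auto
  finally show ?case by (simp only: cost_weight.simps distrib_right mult_1)
qed

text \<open>A total correctness triple with time measured in units of \<open>L + 1\<close>.
  Preserving \<open>bounded_cells\<close> is part of it, since later costs depend on it.\<close>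

definition hoare :: "nat \<Rightarrow> (state \<Rightarrow> bool) \<Rightarrow> com \<Rightarrow> nat \<Rightarrow> (state \<Rightarrow> bool) \<Rightarrow> bool" where
  "hoare L P c k Q \<longleftrightarrow> (\<forall>s. P s \<and> bounded_cells L s \<longrightarrow>
    (\<exists>t s'. exec c s t s' \<and> t \<le> k * (L + 1) \<and> Q s' \<and> bounded_cells L s'))"

abbreviation assign_time :: "exp \<Rightarrow> exp \<Rightarrow> nat" where
  "assign_time a e \<equiv> 1 + cost_weight a + cost_weight e"

lemma hoare_Assign:
  assumes "\<And>s. P s \<Longrightarrow> val e s < 2 ^ L \<and> Q (s(x := (s x)(val a s := val e s)))"
  shows "hoare L P (Assign x a e) (assign_time a e) Q"
  unfolding hoare_def
proof (intro allI impI, elim conjE)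
  fix s assume s: "P s" "bounded_cells L s"
  let ?s = "s(x := (s x)(val a s := val e s))"
  have "1 + cost a s + cost e s \<le> assign_time a e * (L + 1)"
    using cost_le[OF s(2), of a] cost_le[OF s(2), of e] by (simp add: algebra_simps)
  moreover have "bounded_cells L ?s" using s(2) assms[OF s(1)] by (simp add: bounded_cells_def)
  ultimately show "\<exists>t s'. exec (Assign x a e) s t s' \<and> t \<le> assign_time a e * (L + 1) \<and> Q s' \<and> bounded_cells L s'"
    using exec.Assign assms[OF s(1)] by blast
qed

lemma hoare_Seq:
  assumes "hoare L P c k R" "hoare L R d l Q"
  shows "hoare L P (Seq c d) (k + l) Q"
  unfolding hoare_def
proof (intro allI impI, elim conjE)
  fix s assume s: "P s" "bounded_cells L s"
  obtain t r where 1: "exec c s t r" "t \<le> k * (L + 1)" "R r" "bounded_cells L r"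
    using assms(1) s unfolding hoare_def by blast
  obtain u s' where 2: "exec d r u s'" "u \<le> l * (L + 1)" "Q s'" "bounded_cells L s'"
    using assms(2) 1 unfolding hoare_def by blast
  have "t + u \<le> (k + l) * (L + 1)" using 1 2 by (simp add: algebra_simps)
  then show "\<exists>t s'. exec (Seq c d) s t s' \<and> t \<le> (k + l) * (L + 1) \<and> Q s' \<and> bounded_cells L s'"
    using exec.Seq[OF 1(1) 2(1)] 2 by blast
qed

lemma hoare_weaken:
  assumes "hoare L P c k Q" "\<And>s. P' s \<Longrightarrow> P s" "\<And>s. Q s \<Longrightarrow> Q' s"
  shows "hoare L P' c k Q'"
  using assms unfolding hoare_def by blast

abbreviation Var :: "vname \<Rightarrow> exp" where
  "Var x \<equiv> Cell x (Const 0)"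

definition For :: "vname \<Rightarrow> exp \<Rightarrow> com \<Rightarrow> com" where
  "For x b c = Seq (Assign x (Const 0) (Const 0))
    (While (Op Less (Var x) b) (Seq c (Assign x (Const 0) (Op Add (Var x) (Const 1)))))"

text \<open>The empty name stands for any loop variable: weights do not depend on names.\<close>

definition loop_overhead :: "exp \<Rightarrow> nat" where
  "loop_overhead b = 1 + cost_weight (Op Less (Var []) b) +
    assign_time (Const 0) (Op Add (Var []) (Const 1)) + assign_time (Const 0) (Const 0)"

text \<open>Induction on the number \<open>j\<close> of remaining iterations, hence the invariant
  index \<open>N - j\<close>.\<close>

lemma hoare_While_count:
  assumes body: "\<And>i. i < N \<Longrightarrow> hoare L (J i) c k (J (Suc i))"
    and guard: "\<And>i s. i \<le> N \<Longrightarrow> J i s \<Longrightarrow> val b s = of_bool (i < N)"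
  shows "j \<le> N \<Longrightarrow> hoare L (J (N - j)) (While b c) (j * (k + 1 + cost_weight b) + 1 + cost_weight b) (J N)"
proof (induction j)
  case 0
  show ?case
    unfolding hoare_def
  proof (intro allI impI, elim conjE)
    fix s assume s: "J (N - 0) s" "bounded_cells L s"
    have "1 + cost b s \<le> (1 + cost_weight b) * (L + 1)" using cost_le[OF s(2), of b] by simp
    then show "\<exists>t s'. exec (While b c) s t s' \<and> t \<le> (0 * (k + 1 + cost_weight b) + 1 + cost_weight b) * (L + 1) \<and> J N s' \<and> bounded_cells L s'"
      using exec.WhileFalse[of b s c] guard[of N s] s by auto
  qed
next
  case (Suc j)
  let ?w = "1 + cost_weight b"
  have S: "Suc (N - Suc j) = N - j" "N - Suc j < N" using Suc.prems by auto
  show ?case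
    unfolding hoare_def
  proof (intro allI impI, elim conjE)
    fix s assume s: "J (N - Suc j) s" "bounded_cells L s"
    obtain t r where 1: "exec c s t r" "t \<le> k * (L + 1)" "J (N - j) r" "bounded_cells L r"
      using body[OF S(2)] s unfolding hoare_def S(1) by blast
    obtain u s' where 2: "exec (While b c) r u s'" "u \<le> (j * (k + 1 + cost_weight b) + 1 + cost_weight b) * (L + 1)"
      "J N s'" "bounded_cells L s'"
      using Suc.IH Suc.prems 1 unfolding hoare_def by (metis Suc_leD)
    have "val b s \<noteq> 0" using guard[OF _ s(1)] S(2) by simp
    note ex = exec.WhileTrue[OF this 1(1) 2(1)]
    have "1 + cost b s \<le> ?w * (L + 1)" using cost_le[OF s(2), of b] by simp
    then have "1 + cost b s + t + u \<le> ?w * (L + 1) + k * (L + 1) + (j * (k + 1 + cost_weight b) + 1 + cost_weight b) * (L + 1)"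
      using 1(2) 2(2) by linarith
    also have "\<dots> = (Suc j * (k + 1 + cost_weight b) + 1 + cost_weight b) * (L + 1)"
      by (simp add: algebra_simps)
    finally show "\<exists>t s'. exec (While b c) s t s' \<and> t \<le> (Suc j * (k + 1 + cost_weight b) + 1 + cost_weight b) * (L + 1) \<and> J N s' \<and> bounded_cells L s'"
      using ex 2 by blast
  qed
qed

text \<open>The body must leave the counter at \<open>i\<close> and establish the invariant for the
  state in which the counter has already been advanced; the increment itself belongs to the
  loop.\<close>

lemma hoare_For:
  assumes init: "\<And>s. P s \<Longrightarrow> I 0 (s(x := (s x)(0 := 0)))"
    and body: "\<And>i. i < N \<Longrightarrow> hoare L (\<lambda>s. I i s \<and> s x 0 = i) c k (\<lambda>s. I (Suc i) (s(x := (s x)(0 := Suc i))) \<and> s x 0 = i)"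
    and bound: "\<And>i s. I i s \<Longrightarrow> val b s = N"
    and N: "N < 2 ^ L"
  shows "hoare L P (For x b c) (N * (k + loop_overhead b) + loop_overhead b) (I N)"
proof -
  let ?J = "\<lambda>i s. I i s \<and> s x 0 = i"
  let ?a = "assign_time (Const 0) (Op Add (Var []) (Const 1))"
  let ?g = "Op Less (Var x) b"
  have inc: "hoare L (?J i) (Seq c (Assign x (Const 0) (Op Add (Var x) (Const 1)))) (k + ?a) (?J (Suc i))" if "i < N" for i
  proof -
    have "hoare L (\<lambda>s. I (Suc i) (s(x := (s x)(0 := Suc i))) \<and> s x 0 = i) (Assign x (Const 0) (Op Add (Var x) (Const 1)))
      (assign_time (Const 0) (Op Add (Var x) (Const 1))) (?J (Suc i))"
      using that N by (intro hoare_Assign) auto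
    note hoare_Seq[OF body[OF that] this]
    then show ?thesis by (simp only: cost_weight.simps val_weight.simps)
  qed
  have guard: "val ?g s = of_bool (i < N)" if "i \<le> N" "?J i s" for i s
    using bound[of i s] that by auto
  have "hoare L P (Assign x (Const 0) (Const 0)) (assign_time (Const 0) (Const 0)) (?J (N - N))"
    using init by (intro hoare_Assign) auto
  note hoare_Seq[OF this hoare_While_count[of N L ?J _ "k + ?a" ?g N, OF inc guard order_refl]]
  then have "hoare L P (For x b c) (assign_time (Const 0) (Const 0) + (N * (k + ?a + 1 + cost_weight ?g) + 1 + cost_weight ?g)) (?J N)"
    unfolding For_def .
  moreover have "assign_time (Const 0) (Const 0) + (N * (k + ?a + 1 + cost_weight ?g) + 1 + cost_weight ?g)
      \<le> N * (k + loop_overhead b) + loop_overhead b"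
    by (simp add: loop_overhead_def algebra_simps)
  ultimately show ?thesis
    unfolding hoare_def by (meson le_trans mult_le_mono1)
qed

text \<open>The running time of a program is bounded by its \<open>weight\<close>, which depends on the program text
  only, times the number of iterations of its loops.\<close>

primrec weight :: "com \<Rightarrow> nat" where
  "weight Skip = 1"
| "weight (Assign x a e) = assign_time a e"
| "weight (Seq c d) = weight c + weight d"
| "weight (If b c d) = 1 + cost_weight b + weight c + weight d"
| "weight (While b c) = 1 + cost_weight b + weight c"

lemma weight_For: "weight (For x b c) = weight c + loop_overhead b"
  by (simp add: For_def loop_overhead_def)

abbreviation runs :: "nat \<Rightarrow> (state \<Rightarrow> bool) \<Rightarrow> com \<Rightarrow> nat \<Rightarrow> (state \<Rightarrow> bool) \<Rightarrow> bool" where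
  "runs L P c r Q \<equiv> hoare L P c (weight c * r) Q"

lemma hoare_mono: "hoare L P c k Q \<Longrightarrow> k \<le> l \<Longrightarrow> hoare L P c l Q"
  unfolding hoare_def by (meson le_trans mult_le_mono1)

lemma runs_mono: "runs L P c r Q \<Longrightarrow> r \<le> r' \<Longrightarrow> runs L P c r' Q"
  by (erule hoare_mono) simp

lemma runs_Assign:
  assumes "\<And>s. P s \<Longrightarrow> val e s < 2 ^ L \<and> Q (s(x := (s x)(val a s := val e s)))" "1 \<le> r"
  shows "runs L P (Assign x a e) r Q"
proof (rule hoare_mono[OF hoare_Assign])
  show "assign_time a e \<le> weight (Assign x a e) * r"
    using mult_le_mono2[OF assms(2), of "assign_time a e"] by (simp only: weight.simps mult_1_right)
qed (rule assms(1))

lemma runs_Seq: "runs L P c r R \<Longrightarrow> runs L R d r Q \<Longrightarrow> runs L P (Seq c d) r Q"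
  by (rule hoare_mono[OF hoare_Seq]) (auto simp: distrib_right)

lemma runs_For:
  assumes "\<And>s. P s \<Longrightarrow> I 0 (s(x := (s x)(0 := 0)))"
    and "\<And>i. i < N \<Longrightarrow> runs L (\<lambda>s. I i s \<and> s x 0 = i) c r (\<lambda>s. I (Suc i) (s(x := (s x)(0 := Suc i))) \<and> s x 0 = i)"
    and "\<And>i s. I i s \<Longrightarrow> val b s = N"
    and "N < 2 ^ L" "1 \<le> r" "\<And>s. I N s \<Longrightarrow> Q s"
  shows "runs L P (For x b c) ((N + 1) * r) Q"
proof (rule hoare_mono)
  show "hoare L P (For x b c) (N * (weight c * r + loop_overhead b) + loop_overhead b) Q"
    by (rule hoare_weaken[OF hoare_For[where P = P and I = I and N = N]]) (use assms in auto)
  have "(N + 1) * loop_overhead b \<le> (N + 1) * loop_overhead b * r"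
    using mult_le_mono2[OF assms(5), of "(N + 1) * loop_overhead b"] by (simp only: mult_1_right)
  moreover have "N * (weight c * r + loop_overhead b) + loop_overhead b \<le> (N + 1) * weight c * r + (N + 1) * loop_overhead b"
    by (simp add: algebra_simps)
  moreover have "weight (For x b c) * ((N + 1) * r) = (N + 1) * weight c * r + (N + 1) * loop_overhead b * r"
    unfolding weight_For by (simp add: algebra_simps)
  ultimately show "N * (weight c * r + loop_overhead b) + loop_overhead b \<le> weight (For x b c) * ((N + 1) * r)"
    by linarith
qed

section \<open>The program\<close>

abbreviation Add_exp :: "exp \<Rightarrow> exp \<Rightarrow> exp" (infixl \<open>\<oplus>\<close> 65) where "a \<oplus> b \<equiv> Op Add a b"
abbreviation Sub_exp :: "exp \<Rightarrow> exp \<Rightarrow> exp" (infixl \<open>\<ominus>\<close> 65) where "a \<ominus> b \<equiv> Op Sub a b"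
abbreviation Mul_exp :: "exp \<Rightarrow> exp \<Rightarrow> exp" (infixl \<open>\<otimes>\<close> 70) where "a \<otimes> b \<equiv> Op Mul a b"
abbreviation Div_exp :: "exp \<Rightarrow> exp \<Rightarrow> exp" (infixl \<open>\<oslash>\<close> 70) where "a \<oslash> b \<equiv> Op Div a b"
abbreviation Set :: "vname \<Rightarrow> exp \<Rightarrow> com" where "Set x e \<equiv> Assign x (Const 0) e"

text \<open>Cell \<open>i\<close> of the matrix stands for the pair of its row \<open>u\<close> and
  column \<open>v\<close>. \<open>d\<close> sums rows \<open>u\<close> and \<open>v\<close>, giving
  the two degrees, and \<open>y\<close> is the test of \<open>adjust\<close> as a 0-1 value. Both
  symmetric cells are overwritten.\<close>

definition adjust_prog :: com where
  "adjust_prog =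
    Seq (Set ''u'' (Var ''i'' \<oslash> Var ''n''))
    (Seq (Set ''v'' (Var ''i'' \<ominus> Var ''u'' \<otimes> Var ''n''))
    (Seq (Set ''d'' (Const 0))
    (Seq (For ''w'' (Var ''n'') (Set ''d'' (Var ''d'' \<oplus>
      (Cell ''H'' (Var ''u'' \<otimes> Var ''n'' \<oplus> Var ''w'') \<oplus> Cell ''H'' (Var ''v'' \<otimes> Var ''n'' \<oplus> Var ''w'')))))
    (Seq (Set ''y'' (Cell ''G'' (Var ''i'') \<otimes>
      Op Less (Var ''d'' \<oplus> Const 2 \<otimes> (Const 1 \<ominus> Cell ''H'' (Var ''i''))) (Var ''b'' \<oplus> Const 1)))
    (Seq (Assign ''H'' (Var ''i'') (Var ''y''))
    (Assign ''H'' (Var ''v'' \<otimes> Var ''n'' \<oplus> Var ''u'') (Var ''y'')))))))"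

definition count_prog :: com where
  "count_prog = Seq (Set ''c'' (Const 0))
    (For ''i'' (Var ''n'' \<otimes> Var ''n'') (Set ''c'' (Var ''c'' \<oplus> Cell ''H'' (Var ''i''))))"

text \<open>The last assignment computes \<open>min (2 * b) (2 * n + 2)\<close> from \<open>b \<le> 2 * n + 2\<close>, using
  \<open>min x y = x - (x - y)\<close>. The variable \<open>B\<close> holds twice the threshold on the number of edges,
  since \<open>c\<close> counts every edge in both directions.\<close>

definition refine_prog :: com where
  "refine_prog =
    Seq (For ''k'' ((Const 3 \<otimes> Var ''n'' \<oplus> Const 3) \<otimes> Var ''n'' \<otimes> Var ''n'' \<oplus> Const 1)
      (For ''i'' (Var ''n'' \<otimes> Var ''n'') adjust_prog))
    (Seq count_prog
    (Set ''b'' (Var ''b'' \<oplus> Op Less (Var ''c'') (Var ''B'') \<otimes>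
      (Var ''b'' \<ominus> (Var ''b'' \<ominus> (Const 2 \<otimes> Var ''n'' \<oplus> Const 2 \<ominus> Var ''b''))))))"

text \<open>The initial bound is capped at \<open>2 * n + 2\<close> by the same
  truncated-subtraction form of the minimum.\<close>

definition init_prog :: com where
  "init_prog =
    Seq (Set ''m'' (Const 10 \<otimes> (Var ''q'' \<oslash> Var ''p'' \<oplus> Const 1)))
    (Seq (Set ''B'' (Const 2 \<otimes> ((Const 16 \<otimes> Var ''m'' \<otimes> Var ''m'' \<oplus> Const 1) \<otimes> Var ''f'')))
    (Set ''b'' (Const 64 \<otimes> Var ''m'' \<otimes> Var ''m'' \<ominus>
      (Const 64 \<otimes> Var ''m'' \<otimes> Var ''m'' \<ominus> (Const 2 \<otimes> Var ''n'' \<oplus> Const 2)))))"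

definition main_prog :: com where
  "main_prog = Seq init_prog (For ''j'' (Const 2 \<otimes> Var ''n'' \<oplus> Const 3) refine_prog)"

text \<open>The list follows the order of the matrix cells. It contains each edge twice as well as
  singletons from the diagonal; the latter are not edges and leave the subgraph unchanged.\<close>

definition matrix_edges :: "nat \<Rightarrow> nat set list" where
  "matrix_edges n = map (\<lambda>i. {i div n, i mod n}) [0..<n * n]"

lemma cell_less: "u < n \<Longrightarrow> w < n \<Longrightarrow> u * n + w < n * (n::nat)"
  using mult_le_mono1[of "Suc u" n n] by (simp add: mult.commute)

lemma adj_matrix_cell: "u < n \<Longrightarrow> w < n \<Longrightarrow> adj_matrix n H (u * n + w) = of_bool ({u, w} \<in> H)"
  using cell_less[of u n w] by (simp add: adj_matrix_def)

lemma subset_matrix_edges: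
  assumes "graph {..<n} E" shows "E \<subseteq> set (matrix_edges n)"
proof
  fix e assume "e \<in> E"
  then obtain u w where "e = {u, w}" "u < n" "w < n"
    using graph_edge[OF assms] by (force simp: card_2_iff)
  then show "e \<in> set (matrix_edges n)"
    unfolding matrix_edges_def using cell_less[of u n w] by (auto intro!: image_eqI[of _ _ "u * n + w"])
qed

lemma deg_row: "graph {..<n} H \<Longrightarrow> (\<Sum>w<n. of_bool ({u, w} \<in> H)) = deg H u"
  using deg_eq_neighbours(1)[of "{..<n}" H u] by (simp add: insert_commute flip: of_nat_eq_iff[where 'a=real])

lemma sum_adj_matrix:
  assumes "graph {..<n} H" shows "(\<Sum>i<n * n. adj_matrix n H i) = 2 * card H"
proof -
  have "(\<Sum>i<n * n. adj_matrix n H i) = (\<Sum>u<n. sum (adj_matrix n H) {u * n..<u * n + n})"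
    by (rule sum.nat_group[symmetric])
  also have "\<dots> = (\<Sum>u<n. \<Sum>w<n. of_bool ({u, w} \<in> H))"
  proof (rule sum.cong[OF refl])
    fix u assume "u \<in> {..<n}"
    then show "sum (adj_matrix n H) {u * n..<u * n + n} = (\<Sum>w<n. of_bool ({u, w} \<in> H))"
      unfolding sum.atLeastLessThan_shift_0[of _ "u * n"]
      by (auto simp: adj_matrix_cell lessThan_atLeast0 intro!: sum.cong)
  qed
  also have "\<dots> = (\<Sum>u<n. deg H u)" by (simp add: deg_row[OF assms])
  finally show ?thesis using handshake[OF assms] by simp
qed

section \<open>Correctness and running time of the local search program\<close>

definition holds :: "nat \<Rightarrow> nat \<Rightarrow> nat set set \<Rightarrow> nat \<Rightarrow> nat \<Rightarrow> nat \<Rightarrow> state \<Rightarrow> bool" where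
  "holds n B E \<beta> j k s \<longleftrightarrow> s ''G'' = adj_matrix n E \<and> s ''n'' 0 = n \<and> s ''B'' 0 = 2 * B \<and> s ''b'' 0 = \<beta> \<and>
    s ''j'' 0 = j \<and> s ''k'' 0 = k"

text \<open>The factors come from the nested loops over \<open>k\<close>, \<open>i\<close> and
  \<open>w\<close>, each with one added to its iteration count.\<close>

definition refine_rounds :: "nat \<Rightarrow> nat" where
  "refine_rounds n = ((3 * n + 3) * n * n + 2) * ((n * n + 1) * (n + 1))"

context
  fixes n L B :: nat and E :: "nat set set"
  assumes G: "graph {..<n} E" and L: "4 * (n + 1) ^ 3 < 2 ^ L"
begin

lemma L_bounds: "n < 2 ^ L" "n * n < 2 ^ L" "2 * n + 3 < 2 ^ L" "(3 * n + 3) * n * n + 1 < 2 ^ L" "(1::nat) < 2 ^ L"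
proof -
  have "4 * (n + 1) ^ 3 = 4 * (n * n * n) + 12 * (n * n) + 12 * n + 4"
    by (simp add: power3_eq_cube algebra_simps)
  then have *: "4 * (n * n * n) + 12 * (n * n) + 12 * n + 4 < 2 ^ L" using L by simp
  show "n < 2 ^ L" "n * n < 2 ^ L" "2 * n + 3 < 2 ^ L" "(1::nat) < 2 ^ L" using * by linarith+
  have "(3 * n + 3) * n * n + 1 = 3 * (n * n * n) + 3 * (n * n) + 1" by (simp add: algebra_simps)
  then show "(3 * n + 3) * n * n + 1 < 2 ^ L" using * by linarith
qed

lemma runs_adjust:
  assumes i: "i < n * n" and H: "H \<subseteq> E" and \<beta>: "\<beta> < 2 ^ L"
  defines "K \<equiv> adjust \<beta> E {i div n, i mod n} H"
  shows "runs L (\<lambda>s. (holds n B E \<beta> j k s \<and> outputs n H s) \<and> s ''i'' 0 = i) adjust_prog (n + 1)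
    (\<lambda>s. (holds n B E \<beta> j k s \<and> outputs n K s) \<and> s ''i'' 0 = i)"
proof -
  define u v where "u = i div n" and "v = i mod n"
  have n: "n > 0" using i by (cases n) auto
  have uv: "u < n" "v < n" "i = u * n + v"
    using i n by (auto simp: u_def v_def less_mult_imp_div_less)
  have iv: "i - u * n = v" "v * n + u < n * n" using uv cell_less by auto
  define D where "D w = (\<Sum>x<w. of_bool ({u, x} \<in> H) + of_bool ({v, x} \<in> H) :: nat)" for w
  have Dle: "D w \<le> 2 * n" if "w \<le> n" for w
  proof -
    have "D w \<le> (\<Sum>x<w. 2)" unfolding D_def by (intro sum_mono) auto
    then show ?thesis using that by simp
  qed
  have GH: "graph {..<n} H" using graph_mono[OF G H] .
  have Dn: "D n = deg H u + deg H v"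
    unfolding D_def sum.distrib using deg_row[OF GH] by simp
  let ?y = "of_bool ({u, v} \<in> K) :: nat"
  \<comment> \<open>If \<open>{u, v}\<close> is an edge then \<open>u \<noteq> v\<close>, so the sum
    over its elements in \<open>adjust\<close> is \<open>deg H u + deg H v\<close>; otherwise the
    matrix entry of \<open>E\<close> makes the product 0.\<close>
  have y: "of_bool ({u, v} \<in> E) * of_bool (D n + 2 * (1 - of_bool ({u, v} \<in> H)) < \<beta> + 1) = ?y"
  proof (cases "{u, v} \<in> E")
    case True
    then have "u \<noteq> v" using graph_edge[OF G True] by auto
    then show ?thesis using True Dn by (auto simp: K_def adjust_def u_def v_def)
  next
    case False
    then show ?thesis using H by (auto simp: K_def adjust_def u_def v_def)
  qed
  have K: "{a, b} \<in> K \<longleftrightarrow> {a, b} \<in> H" if "{a, b} \<noteq> {u, v}" for a b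
    using that by (auto simp: K_def adjust_def u_def v_def)
  let ?P0 = "\<lambda>s. (holds n B E \<beta> j k s \<and> outputs n H s) \<and> s ''i'' 0 = i"
  let ?P1 = "\<lambda>s. ?P0 s \<and> s ''u'' 0 = u"
  let ?P2 = "\<lambda>s. ?P1 s \<and> s ''v'' 0 = v"
  let ?P3 = "\<lambda>w s. ?P2 s \<and> s ''d'' 0 = D w"
  let ?P4 = "\<lambda>s. ?P2 s \<and> s ''y'' 0 = ?y"
  \<comment> \<open>Between the two writes only cell \<open>i\<close> is updated, so the matrix may
    be asymmetric and need not encode any graph.\<close>
  let ?P5 = "\<lambda>s. holds n B E \<beta> j k s \<and> s ''i'' 0 = i \<and> s ''u'' 0 = u \<and> s ''v'' 0 = v \<and> s ''y'' 0 = ?y \<and>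
    (\<forall>l<n * n. s ''H'' l = (if l = i then ?y else adj_matrix n H l))"
  note st = holds_def outputs_def
  have "runs L (?P3 0) (For ''w'' (Var ''n'') (Set ''d'' (Var ''d'' \<oplus>
      (Cell ''H'' (Var ''u'' \<otimes> Var ''n'' \<oplus> Var ''w'') \<oplus> Cell ''H'' (Var ''v'' \<otimes> Var ''n'' \<oplus> Var ''w'')))))
      ((n + 1) * 1) (?P3 n)"
  proof (rule runs_For[where I = "?P3"])
    fix w assume w: "w < n"
    have "D (Suc w) < 2 ^ L" using Dle[of "Suc w"] w L_bounds(3) by linarith
    then show "runs L (\<lambda>s. ?P3 w s \<and> s ''w'' 0 = w) (Set ''d'' (Var ''d'' \<oplus>
      (Cell ''H'' (Var ''u'' \<otimes> Var ''n'' \<oplus> Var ''w'') \<oplus> Cell ''H'' (Var ''v'' \<otimes> Var ''n'' \<oplus> Var ''w'')))) 1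
      (\<lambda>s. ?P3 (Suc w) (s(''w'' := (s ''w'')(0 := Suc w))) \<and> s ''w'' 0 = w)"
      using w uv by (intro runs_Assign) (auto simp: st adj_matrix_cell cell_less D_def)
  qed (use L_bounds in \<open>auto simp: st\<close>)
  then have loop: "runs L (?P3 0) (For ''w'' (Var ''n'') (Set ''d'' (Var ''d'' \<oplus>
      (Cell ''H'' (Var ''u'' \<otimes> Var ''n'' \<oplus> Var ''w'') \<oplus> Cell ''H'' (Var ''v'' \<otimes> Var ''n'' \<oplus> Var ''w'')))))
      (n + 1) (?P3 n)" by simp
  have cell_i: "s ''H'' i = of_bool ({u, v} \<in> H)" if "outputs n H s" for s :: state
    using that i uv adj_matrix_cell by (simp add: outputs_def)
  have G_i: "adj_matrix n E i = of_bool ({u, v} \<in> E)" using uv adj_matrix_cell by simp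
  \<comment> \<open>Exactly the cells \<open>i\<close> and \<open>v * n + u\<close> encode the pair
    \<open>{u, v}\<close>; all others keep their value.\<close>
  have last: "outputs n K (s(''H'' := (s ''H'')(v * n + u := ?y)))" if s: "?P5 s" for s
    unfolding outputs_def
  proof (intro allI impI)
    fix l assume l: "l < n * n"
    show "(s(''H'' := (s ''H'')(v * n + u := ?y))) ''H'' l = adj_matrix n K l"
    proof (cases "{l div n, l mod n} = {u, v}")
      case True
      then have "l = i \<or> l = v * n + u" using uv by (metis div_mult_mod_eq doubleton_eq_iff)
      then show ?thesis using s l True by (auto simp: adj_matrix_def)
    next
      case False
      then have "l \<noteq> i" "l \<noteq> v * n + u" using uv by (auto simp: u_def[symmetric] v_def[symmetric] insert_commute)
      then show ?thesis using s l K[OF False] by (simp add: adj_matrix_def)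
    qed
  qed
  have one: "1 \<le> n + 1" by simp
  show ?thesis
    unfolding adjust_prog_def
  proof (intro runs_Seq)
    show "runs L ?P0 (Set ''u'' (Var ''i'' \<oslash> Var ''n'')) (n + 1) ?P1"
      using less_trans[OF uv(1) L_bounds(1)] by (intro runs_Assign) (auto simp: st u_def[symmetric])
    show "runs L ?P1 (Set ''v'' (Var ''i'' \<ominus> Var ''u'' \<otimes> Var ''n'')) (n + 1) ?P2"
      using less_trans[OF uv(2) L_bounds(1)] iv(1) by (intro runs_Assign) (auto simp: st)
    show "runs L ?P2 (Set ''d'' (Const 0)) (n + 1) (?P3 0)"
      by (intro runs_Assign) (auto simp: st D_def)
    show "runs L (?P3 n) (Set ''y'' (Cell ''G'' (Var ''i'') \<otimes>
      Op Less (Var ''d'' \<oplus> Const 2 \<otimes> (Const 1 \<ominus> Cell ''H'' (Var ''i''))) (Var ''b'' \<oplus> Const 1))) (n + 1) ?P4"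
    proof (intro runs_Assign one)
      fix s assume s: "?P3 n s"
      have "val (Cell ''G'' (Var ''i'') \<otimes>
        Op Less (Var ''d'' \<oplus> Const 2 \<otimes> (Const 1 \<ominus> Cell ''H'' (Var ''i''))) (Var ''b'' \<oplus> Const 1)) s = ?y"
        using s cell_i[of s] unfolding y[symmetric] holds_def by (simp add: G_i)
      moreover have "?y < 2 ^ L" using L_bounds(5) by simp
      ultimately show "val (Cell ''G'' (Var ''i'') \<otimes>
        Op Less (Var ''d'' \<oplus> Const 2 \<otimes> (Const 1 \<ominus> Cell ''H'' (Var ''i''))) (Var ''b'' \<oplus> Const 1)) s < 2 ^ L \<and>
        ?P4 (s(''y'' := (s ''y'')(val (Const 0) s := val (Cell ''G'' (Var ''i'') \<otimes>
        Op Less (Var ''d'' \<oplus> Const 2 \<otimes> (Const 1 \<ominus> Cell ''H'' (Var ''i''))) (Var ''b'' \<oplus> Const 1)) s)))"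
        using s by (simp add: st)
    qed
    show "runs L ?P4 (Assign ''H'' (Var ''i'') (Var ''y'')) (n + 1) ?P5"
      using L_bounds(5) by (intro runs_Assign) (auto simp: st)
    show "runs L ?P5 (Assign ''H'' (Var ''v'' \<otimes> Var ''n'' \<oplus> Var ''u'') (Var ''y'')) (n + 1)
      (\<lambda>s. (holds n B E \<beta> j k s \<and> outputs n K s) \<and> s ''i'' 0 = i)"
    proof (intro runs_Assign one)
      fix s assume s: "?P5 s"
      have "val (Var ''v'' \<otimes> Var ''n'' \<oplus> Var ''u'') s = v * n + u" "val (Var ''y'') s = ?y"
        using s by (auto simp: holds_def)
      then show "val (Var ''y'') s < 2 ^ L \<and> (holds n B E \<beta> j k (s(''H'' := (s ''H'')(val (Var ''v'' \<otimes> Var ''n'' \<oplus> Var ''u'') s := val (Var ''y'') s))) \<and>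
        outputs n K (s(''H'' := (s ''H'')(val (Var ''v'' \<otimes> Var ''n'' \<oplus> Var ''u'') s := val (Var ''y'') s)))) \<and>
        (s(''H'' := (s ''H'')(val (Var ''v'' \<otimes> Var ''n'' \<oplus> Var ''u'') s := val (Var ''y'') s))) ''i'' 0 = i"
        using last[OF s] s L_bounds(5) by (simp add: holds_def)
    qed
  qed (use loop in auto)
qed

lemma runs_sweep:
  assumes H: "H \<subseteq> E" and \<beta>: "\<beta> < 2 ^ L"
  shows "runs L (\<lambda>s. holds n B E \<beta> j k s \<and> outputs n H s) (For ''i'' (Var ''n'' \<otimes> Var ''n'') adjust_prog)
    ((n * n + 1) * (n + 1)) (\<lambda>s. holds n B E \<beta> j k s \<and> outputs n (sweep \<beta> E (matrix_edges n) H) s)"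
proof (rule runs_For[where I = "\<lambda>i s. holds n B E \<beta> j k s \<and>
    outputs n (sweep \<beta> E (map (\<lambda>i. {i div n, i mod n}) [0..<i]) H) s"])
  fix i assume i: "i < n * n"
  let ?K = "sweep \<beta> E (map (\<lambda>i. {i div n, i mod n}) [0..<i]) H"
  have "?K \<subseteq> E" using H by (rule sweep_subset)
  moreover have "sweep \<beta> E (map (\<lambda>i. {i div n, i mod n}) [0..<Suc i]) H = adjust \<beta> E {i div n, i mod n} ?K"
    by (simp add: sweep_def)
  ultimately show "runs L (\<lambda>s. (holds n B E \<beta> j k s \<and> outputs n ?K s) \<and> s ''i'' 0 = i) adjust_prog (n + 1)
    (\<lambda>s. (holds n B E \<beta> j k (s(''i'' := (s ''i'')(0 := Suc i))) \<and>
      outputs n (sweep \<beta> E (map (\<lambda>i. {i div n, i mod n}) [0..<Suc i]) H) (s(''i'' := (s ''i'')(0 := Suc i)))) \<and>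
      s ''i'' 0 = i)"
    using runs_adjust[OF i _ \<beta>, of ?K j k] by (simp add: holds_def outputs_def)
qed (use L_bounds in \<open>auto simp: holds_def outputs_def sweep_def matrix_edges_def\<close>)

lemma runs_count:
  assumes H: "H \<subseteq> E" and r: "n * n + 1 \<le> r"
  shows "runs L (\<lambda>s. holds n B E \<beta> j k s \<and> outputs n H s) count_prog r
    (\<lambda>s. (holds n B E \<beta> j k s \<and> outputs n H s) \<and> s ''c'' 0 = 2 * card H)"
  unfolding count_prog_def
proof (rule runs_Seq)
  let ?P = "\<lambda>i s. (holds n B E \<beta> j k s \<and> outputs n H s) \<and> s ''c'' 0 = (\<Sum>l<i. adj_matrix n H l)"
  show "runs L (\<lambda>s. holds n B E \<beta> j k s \<and> outputs n H s) (Set ''c'' (Const 0)) r (?P 0)"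
    using r by (intro runs_Assign) (auto simp: holds_def outputs_def)
  have "runs L (?P 0) (For ''i'' (Var ''n'' \<otimes> Var ''n'') (Set ''c'' (Var ''c'' \<oplus> Cell ''H'' (Var ''i''))))
    ((n * n + 1) * 1) (?P (n * n))"
  proof (rule runs_For[where I = ?P])
    fix i assume i: "i < n * n"
    have "(\<Sum>l<Suc i. adj_matrix n H l) \<le> (\<Sum>l<Suc i. 1)" by (intro sum_mono) (simp add: adj_matrix_def)
    then have "(\<Sum>l<Suc i. adj_matrix n H l) < 2 ^ L" using i L_bounds(2) by simp
    then show "runs L (\<lambda>s. ?P i s \<and> s ''i'' 0 = i) (Set ''c'' (Var ''c'' \<oplus> Cell ''H'' (Var ''i''))) 1
      (\<lambda>s. ?P (Suc i) (s(''i'' := (s ''i'')(0 := Suc i))) \<and> s ''i'' 0 = i)"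
      using i by (intro runs_Assign) (auto simp: holds_def outputs_def)
  qed (use L_bounds in \<open>auto simp: holds_def outputs_def\<close>)
  then show "runs L (?P 0) (For ''i'' (Var ''n'' \<otimes> Var ''n'') (Set ''c'' (Var ''c'' \<oplus> Cell ''H'' (Var ''i'')))) r
    (\<lambda>s. (holds n B E \<beta> j k s \<and> outputs n H s) \<and> s ''c'' 0 = 2 * card H)"
    unfolding sum_adj_matrix[OF graph_mono[OF G H]] by (rule runs_mono) (use r in simp)
qed

text \<open>The value of \<open>k\<close> is left open because the counter retains its final value
  from the previous round and is reset by the loop.\<close>

lemma runs_refine:
  assumes H: "H \<subseteq> E" and \<beta>: "\<beta> \<le> 2 * n + 2"
    and step: "refine n B E (matrix_edges n) (\<beta>, H) = (\<beta>', H')"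
  shows "runs L (\<lambda>s. (\<exists>k. holds n B E \<beta> j k s) \<and> outputs n H s) refine_prog (refine_rounds n)
    (\<lambda>s. (\<exists>k. holds n B E \<beta>' j k s) \<and> outputs n H' s)"
proof -
  let ?N = "(3 * n + 3) * n * n + 1"
  let ?sw = "sweep \<beta> E (matrix_edges n)"
  have \<beta>L: "\<beta> < 2 ^ L" using \<beta> L_bounds(3) by linarith
  have st: "H' = (?sw ^^ ?N) H" "\<beta>' = (if card H' < B then min (2 * \<beta>) (2 * n + 2) else \<beta>)"
    using step by (auto simp only: refine_def Let_def prod.case prod.inject)
  have H': "H' \<subseteq> E" unfolding st(1) using H by (rule sweep_iter_subset)
  have \<beta>': "\<beta>' = \<beta> + of_bool (2 * card H' < 2 * B) * (\<beta> - (\<beta> - (2 * n + 2 - \<beta>)))" "\<beta>' < 2 ^ L"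
    using st(2) \<beta> \<beta>L L_bounds(3) by (auto simp: min_def)
  have rr: "n * n + 1 \<le> refine_rounds n" "1 \<le> refine_rounds n"
    by (simp_all add: refine_rounds_def)
  show ?thesis
    unfolding refine_prog_def
  proof (intro runs_Seq)
    have "runs L (\<lambda>s. (\<exists>k. holds n B E \<beta> j k s) \<and> outputs n H s)
      (For ''k'' ((Const 3 \<otimes> Var ''n'' \<oplus> Const 3) \<otimes> Var ''n'' \<otimes> Var ''n'' \<oplus> Const 1)
        (For ''i'' (Var ''n'' \<otimes> Var ''n'') adjust_prog)) ((?N + 1) * ((n * n + 1) * (n + 1)))
      (\<lambda>s. holds n B E \<beta> j ?N s \<and> outputs n H' s)"
    proof (rule runs_For[where I = "\<lambda>k s. holds n B E \<beta> j k s \<and> outputs n ((?sw ^^ k) H) s"])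
      fix k assume "k < ?N"
      have "(?sw ^^ k) H \<subseteq> E" using H by (rule sweep_iter_subset)
      then show "runs L (\<lambda>s. (holds n B E \<beta> j k s \<and> outputs n ((?sw ^^ k) H) s) \<and> s ''k'' 0 = k)
        (For ''i'' (Var ''n'' \<otimes> Var ''n'') adjust_prog) ((n * n + 1) * (n + 1))
        (\<lambda>s. (holds n B E \<beta> j (Suc k) (s(''k'' := (s ''k'')(0 := Suc k))) \<and>
          outputs n ((?sw ^^ Suc k) H) (s(''k'' := (s ''k'')(0 := Suc k)))) \<and> s ''k'' 0 = k)"
        by (intro hoare_weaken[OF runs_sweep[OF _ \<beta>L]]) (auto simp: holds_def outputs_def)
    qed (use L_bounds in \<open>auto simp: holds_def outputs_def st(1)\<close>)
    then show "runs L (\<lambda>s. (\<exists>k. holds n B E \<beta> j k s) \<and> outputs n H s)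
      (For ''k'' ((Const 3 \<otimes> Var ''n'' \<oplus> Const 3) \<otimes> Var ''n'' \<otimes> Var ''n'' \<oplus> Const 1)
        (For ''i'' (Var ''n'' \<otimes> Var ''n'') adjust_prog)) (refine_rounds n)
      (\<lambda>s. holds n B E \<beta> j ?N s \<and> outputs n H' s)"
      by (simp only: refine_rounds_def add.assoc one_add_one)
    show "runs L (\<lambda>s. holds n B E \<beta> j ?N s \<and> outputs n H' s) count_prog (refine_rounds n)
      (\<lambda>s. (holds n B E \<beta> j ?N s \<and> outputs n H' s) \<and> s ''c'' 0 = 2 * card H')"
      using runs_count[OF H' rr(1)] .
    show "runs L (\<lambda>s. (holds n B E \<beta> j ?N s \<and> outputs n H' s) \<and> s ''c'' 0 = 2 * card H')
      (Set ''b'' (Var ''b'' \<oplus> Op Less (Var ''c'') (Var ''B'') \<otimes>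
      (Var ''b'' \<ominus> (Var ''b'' \<ominus> (Const 2 \<otimes> Var ''n'' \<oplus> Const 2 \<ominus> Var ''b''))))) (refine_rounds n)
      (\<lambda>s. (\<exists>k. holds n B E \<beta>' j k s) \<and> outputs n H' s)"
    proof (intro runs_Assign rr)
      fix s assume s: "(holds n B E \<beta> j ?N s \<and> outputs n H' s) \<and> s ''c'' 0 = 2 * card H'"
      let ?e = "Var ''b'' \<oplus> Op Less (Var ''c'') (Var ''B'') \<otimes>
        (Var ''b'' \<ominus> (Var ''b'' \<ominus> (Const 2 \<otimes> Var ''n'' \<oplus> Const 2 \<ominus> Var ''b'')))"
      have "val ?e s = \<beta>'" using s unfolding \<beta>'(1) by (simp add: holds_def)
      moreover have "holds n B E \<beta>' j ?N (s(''b'' := (s ''b'')(0 := \<beta>')))" "outputs n H' (s(''b'' := (s ''b'')(0 := \<beta>')))"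
        using s by (auto simp: holds_def outputs_def)
      ultimately show "val ?e s < 2 ^ L \<and> (\<exists>k. holds n B E \<beta>' j k (s(''b'' := (s ''b'')(val (Const 0) s := val ?e s)))) \<and>
        outputs n H' (s(''b'' := (s ''b'')(val (Const 0) s := val ?e s)))"
        using \<beta>'(2) by auto
    qed
  qed
qed

lemma runs_refine_iter:
  assumes \<beta>: "\<beta> \<le> 2 * n + 2"
    and iter: "(refine n B E (matrix_edges n) ^^ (2 * n + 3)) (\<beta>, {}) = (\<beta>', H')"
  shows "runs L (\<lambda>s. (\<exists>j k. holds n B E \<beta> j k s) \<and> outputs n {} s)
    (For ''j'' (Const 2 \<otimes> Var ''n'' \<oplus> Const 3) refine_prog) ((2 * n + 4) * refine_rounds n) (outputs n H')"
proof -
  let ?it = "\<lambda>j. (refine n B E (matrix_edges n) ^^ j) (\<beta>, {})"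
  let ?I = "\<lambda>j s. (\<exists>k. holds n B E (fst (?it j)) j k s) \<and> outputs n (snd (?it j)) s"
  have inv: "fst (?it j) \<le> 2 * n + 2 \<and> snd (?it j) \<subseteq> E" for j
  proof (induction j)
    case 0 then show ?case using \<beta> by simp
  next
    case (Suc j)
    then show ?case
      using sweep_iter_subset[of "snd (?it j)" E "(3 * n + 3) * n * n + 1" "fst (?it j)" "matrix_edges n"]
      by (simp add: refine_def Let_def case_prod_unfold del: funpow.simps(2)) (simp add: refine_def Let_def case_prod_unfold)
  qed
  have "runs L (\<lambda>s. (\<exists>j k. holds n B E \<beta> j k s) \<and> outputs n {} s)
    (For ''j'' (Const 2 \<otimes> Var ''n'' \<oplus> Const 3) refine_prog) ((2 * n + 3 + 1) * refine_rounds n) (outputs n H')"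
  proof (rule runs_For[where I = ?I])
    fix j
    have "refine n B E (matrix_edges n) (fst (?it j), snd (?it j)) = (fst (?it (Suc j)), snd (?it (Suc j)))" by simp
    note runs_refine[OF conjunct2[OF inv[of j]] conjunct1[OF inv[of j]] this, of j]
    then show "runs L (\<lambda>s. ?I j s \<and> s ''j'' 0 = j) refine_prog (refine_rounds n)
      (\<lambda>s. ?I (Suc j) (s(''j'' := (s ''j'')(0 := Suc j))) \<and> s ''j'' 0 = j)"
      by (rule hoare_weaken) (auto simp: holds_def outputs_def)
  qed (use L_bounds iter in \<open>auto simp: holds_def outputs_def refine_rounds_def\<close>)
  then show ?thesis by (simp add: numeral_eq_Suc)
qed

end

section \<open>Sizes of the numbers and the polynomial time bound\<close>

lemma input_length_bounds:
  fixes n f p q :: nat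
  assumes "f \<ge> 1"
  defines "X \<equiv> 2 ^ input_length n f p q"
  shows "n + 1 \<le> X" "f \<le> X" "q + 1 \<le> X" "2 \<le> X" "input_state n E f p q x i < X"
proof -
  let ?l = "input_length n f p q"
  have lt: "v < X" if "bits v \<le> ?l" for v using that unfolding X_def bits_le_iff .
  have "bits n \<le> ?l" "bits f \<le> ?l" "bits p \<le> ?l" "bits q \<le> ?l" by (simp_all add: input_length_def)
  then have vals: "n < X" "f < X" "p < X" "q < X" using lt by blast+
  then show "n + 1 \<le> X" "f \<le> X" "q + 1 \<le> X" by auto
  show "2 \<le> X" using vals(2) assms(1) by linarith
  then show "input_state n E f p q x i < X" using vals by (simp add: input_state_def adj_matrix_def)
qed

text \<open>With \<open>X\<close> the power of 2 to the input length, \<open>m\<close> is at most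
  \<open>10 * X\<close> and the stored threshold at most \<open>3202 * X ^ 3\<close>. This is below
  \<open>4096 * X ^ 3 = 2 ^ L\<close>, which explains the constants in \<open>L\<close>.\<close>

lemma runs_init:
  fixes n f p q :: nat and E :: "nat set set"
  assumes f: "f \<ge> 1"
  defines "L \<equiv> 3 * input_length n f p q + 12" and "m \<equiv> 10 * (q div p + 1)"
  shows "runs L (\<lambda>s. s = input_state n E f p q) init_prog 1
      (\<lambda>s. (\<exists>j k. holds n ((16 * m\<^sup>2 + 1) * f) E (min (64 * m\<^sup>2) (2 * n + 2)) j k s) \<and> outputs n {} s)"
    and "4 * (n + 1) ^ 3 < 2 ^ L" and "bounded_cells L (input_state n E f p q)"
proof -
  define X :: nat where "X = 2 ^ input_length n f p q"
  note X = input_length_bounds[OF f, where n = n and p = p and q = q, folded X_def]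
  have L: "(2::nat) ^ L = 4096 * X ^ 3"
    unfolding L_def X_def power_add power_mult[symmetric] by (simp add: mult.commute)
  have X1: "1 \<le> X ^ 3" "X \<le> X ^ 3" "X ^ 2 \<le> X ^ 3"
    using X(4) power_increasing[of 1 3 X] power_increasing[of 2 3 X] by auto
  have "(n + 1) ^ 3 \<le> X ^ 3" using X(1) by (rule power_mono) simp
  then show n3: "4 * (n + 1) ^ 3 < 2 ^ L" using X1(1) unfolding L by linarith
  show "bounded_cells L (input_state n E f p q)"
    unfolding bounded_cells_def
  proof (intro allI)
    fix x i
    show "input_state n E f p q x i < 2 ^ L"
      using X(5)[where E = E and x = x and i = i] X1(1,2) unfolding L by linarith
  qed
  have n2: "2 * n + 2 < 2 ^ L" using X(1) X1 unfolding L by linarith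
  have mX: "m \<le> 10 * X"
  proof -
    have "q div p + 1 \<le> q + 1" by simp
    then show ?thesis unfolding m_def using le_trans[OF _ X(3)] by (intro mult_le_mono2)
  qed
  then have mL: "m < 2 ^ L" using X1 unfolding L by linarith
  have "m * m \<le> (10 * X) * (10 * X)" using mX by (intro mult_mono) auto
  then have "m * m \<le> 100 * X ^ 2" by (simp add: power2_eq_square)
  moreover have "1 \<le> X ^ 2" using X(4) by simp
  ultimately have "16 * m * m + 1 \<le> 1601 * X ^ 2" by (simp only: mult.assoc)
  then have "(16 * m * m + 1) * f \<le> (1601 * X ^ 2) * X" using X(2) by (intro mult_mono) auto
  also have "\<dots> = 1601 * X ^ 3" by (simp add: power2_eq_square power3_eq_cube)
  finally have BL: "2 * ((16 * m * m + 1) * f) < 2 ^ L" using X1(1) unfolding L by linarith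
  let ?in = "input_state n E f p q"
  let ?P = "\<lambda>s. (\<forall>x. x \<noteq> ''m'' \<longrightarrow> s x = ?in x) \<and> s ''m'' 0 = m"
  let ?Q = "\<lambda>s. (\<forall>x. x \<noteq> ''m'' \<and> x \<noteq> ''B'' \<longrightarrow> s x = ?in x) \<and> s ''m'' 0 = m \<and> s ''B'' 0 = 2 * ((16 * m * m + 1) * f)"
  show "runs L (\<lambda>s. s = ?in) init_prog 1
      (\<lambda>s. (\<exists>j k. holds n ((16 * m\<^sup>2 + 1) * f) E (min (64 * m\<^sup>2) (2 * n + 2)) j k s) \<and> outputs n {} s)"
    unfolding init_prog_def
  proof (intro runs_Seq)
    show "runs L (\<lambda>s. s = ?in) (Set ''m'' (Const 10 \<otimes> (Var ''q'' \<oslash> Var ''p'' \<oplus> Const 1))) 1 ?P"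
      using mL by (intro runs_Assign) (auto simp: input_state_def m_def)
    show "runs L ?P (Set ''B'' (Const 2 \<otimes> ((Const 16 \<otimes> Var ''m'' \<otimes> Var ''m'' \<oplus> Const 1) \<otimes> Var ''f''))) 1 ?Q"
      using BL by (intro runs_Assign) (auto simp: input_state_def)
    show "runs L ?Q (Set ''b'' (Const 64 \<otimes> Var ''m'' \<otimes> Var ''m'' \<ominus>
      (Const 64 \<otimes> Var ''m'' \<otimes> Var ''m'' \<ominus> (Const 2 \<otimes> Var ''n'' \<oplus> Const 2)))) 1
      (\<lambda>s. (\<exists>j k. holds n ((16 * m\<^sup>2 + 1) * f) E (min (64 * m\<^sup>2) (2 * n + 2)) j k s) \<and> outputs n {} s)"
    proof (intro runs_Assign order_refl)
      fix s assume s: "?Q s"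
      let ?e = "Const 64 \<otimes> Var ''m'' \<otimes> Var ''m'' \<ominus>
        (Const 64 \<otimes> Var ''m'' \<otimes> Var ''m'' \<ominus> (Const 2 \<otimes> Var ''n'' \<oplus> Const 2))"
      let ?s = "s(''b'' := (s ''b'')(val (Const 0) s := val ?e s))"
      have e: "val ?e s = min (64 * m\<^sup>2) (2 * n + 2)"
        using s by (simp add: input_state_def power2_eq_square min_def)
      then have "val ?e s < 2 ^ L" using n2 by simp
      moreover have "holds n ((16 * m\<^sup>2 + 1) * f) E (min (64 * m\<^sup>2) (2 * n + 2)) 0 0 ?s"
        using s unfolding e by (auto simp: holds_def input_state_def power2_eq_square)
      moreover have "outputs n {} ?s"
        using s by (auto simp: outputs_def adj_matrix_def input_state_def)
      ultimately show "val ?e s < 2 ^ L \<and>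
        (\<exists>j k. holds n ((16 * m\<^sup>2 + 1) * f) E (min (64 * m\<^sup>2) (2 * n + 2)) j k ?s) \<and> outputs n {} ?s"
        by blast
    qed
  qed
qed

text \<open>The factors bound the program weight, the loop counts with \<open>n\<close> replaced by
  the input length, and \<open>L + 1\<close>.\<close>

definition time_poly :: "nat poly" where
  "time_poly = (let x = [:0, 1:] in [:weight main_prog:] *
    ((2 * x + 4) * (((3 * x + 3) * x * x + 2) * ((x * x + 1) * (x + 1)))) * (3 * x + 13))"

lemma exec_main_prog:
  fixes n f p q :: nat and E :: "nat set set"
  assumes G: "graph {..<n} E" and f: "f \<ge> 1"
  defines "m \<equiv> 10 * (q div p + 1)"
  assumes iter: "(refine n ((16 * m\<^sup>2 + 1) * f) E (matrix_edges n) ^^ (2 * n + 3)) (min (64 * m\<^sup>2) (2 * n + 2), {}) = (\<beta>, H)"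
  shows "\<exists>t s. exec main_prog (input_state n E f p q) t s \<and> t \<le> poly time_poly (input_length n f p q) \<and> outputs n H s"
proof -
  let ?l = "input_length n f p q"
  define L where "L = 3 * ?l + 12"
  let ?r = "(2 * n + 4) * refine_rounds n"
  note init = runs_init(1)[OF f, where n = n and p = p and q = q and E = E, folded L_def m_def]
    runs_init(2)[OF f, where n = n and p = p and q = q, folded L_def]
    runs_init(3)[OF f, where n = n and p = p and q = q and E = E, folded L_def]
  have "1 \<le> ?r" by (simp add: refine_rounds_def)
  then have "runs L (\<lambda>s. s = input_state n E f p q) main_prog ?r (outputs n H)"
    unfolding main_prog_def
    by (intro runs_Seq[OF runs_mono[OF init(1)] runs_refine_iter[OF G init(2) _ iter]]) simp_all
  then obtain t s where ts: "exec main_prog (input_state n E f p q) t s" "t \<le> weight main_prog * ?r * (L + 1)" "outputs n H s"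
    using init(3) unfolding hoare_def by blast
  \<comment> \<open>The matrix contributes \<open>n * n\<close> to the input length, so time
    polynomial in \<open>n\<close> is polynomial in the input length.\<close>
  have nl: "n \<le> ?l" by (cases n) (auto simp: input_length_def)
  have r: "?r \<le> (2 * ?l + 4) * (((3 * ?l + 3) * ?l * ?l + 2) * ((?l * ?l + 1) * (?l + 1)))"
    unfolding refine_rounds_def using nl by (intro mult_le_mono add_le_mono) simp_all
  have L13: "L + 1 = 3 * ?l + 13" by (simp add: L_def)
  have "weight main_prog * ?r * (L + 1) \<le> weight main_prog *
    ((2 * ?l + 4) * (((3 * ?l + 3) * ?l * ?l + 2) * ((?l * ?l + 1) * (?l + 1)))) * (3 * ?l + 13)"
    unfolding L13 by (rule mult_le_mono1[OF mult_le_mono2[OF r]])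
  also have "\<dots> = poly time_poly ?l"
    by (simp add: time_poly_def Let_def del: mult_pCons_left mult_pCons_right)
  finally show ?thesis using ts le_trans by blast
qed

text \<open>Capping \<open>\<epsilon>\<close> at 1/2 in the size bound keeps the logarithm positive
  when \<open>\<epsilon>\<close> is large.\<close>

theorem theorem6p1:
  "\<exists>(c :: com) (P :: nat poly) (C :: real).
     \<forall>(\<epsilon> :: real) (f :: nat) (n :: nat) (E :: nat set set) (p :: nat) (q :: nat).
       \<epsilon> > 0 \<and> f \<ge> 1 \<and> graph {..<n} E \<and> represents p q \<epsilon> \<longrightarrow>
       (\<exists>t s H.
          exec c (input_state n E f p q) t s \<and>
          t \<le> poly P (input_length n f p q) \<and>
          outputs n H s \<and>
          tolerant_subgraph (3/2 + \<epsilon>) f E H \<and>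
          real (card H) \<le> C * ((real n * ln (1 / min \<epsilon> (1/2)) + real f) / (min \<epsilon> (1/2))\<^sup>2))"
proof (intro exI[of _ main_prog] exI[of _ time_poly] exI[of _ "200000::real"] allI impI)
  fix \<epsilon> :: real and f n p q :: nat and E :: "nat set set"
  assume "\<epsilon> > 0 \<and> f \<ge> 1 \<and> graph {..<n} E \<and> represents p q \<epsilon>"
  then have h: "\<epsilon> > 0" "f \<ge> 1" "graph {..<n} E" "represents p q \<epsilon>" by auto
  let ?m = "10 * (q div p + 1)"
  obtain \<beta> H where it: "(refine n ((16 * ?m\<^sup>2 + 1) * f) E (matrix_edges n) ^^ (2 * n + 3)) (min (64 * ?m\<^sup>2) (2 * n + 2), {}) = (\<beta>, H)"
    and H: "tolerant_subgraph (3/2 + \<epsilon>) f E H"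
      "real (card H) \<le> 200000 * ((real n * ln (1 / min \<epsilon> (1/2)) + real f) / (min \<epsilon> (1/2))\<^sup>2)"
    using refine_tolerant[OF h(3) subset_matrix_edges[OF h(3)] h(1) h(4), of f] unfolding card_lessThan by metis
  show "\<exists>t s H. exec main_prog (input_state n E f p q) t s \<and> t \<le> poly time_poly (input_length n f p q) \<and>
      outputs n H s \<and> tolerant_subgraph (3/2 + \<epsilon>) f E H \<and>
      real (card H) \<le> 200000 * ((real n * ln (1 / min \<epsilon> (1/2)) + real f) / (min \<epsilon> (1/2))\<^sup>2)"
    using exec_main_prog[OF h(3,2) it] H by blast
qed

end
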